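(* Let $E$ be a euclidean group (infinite) and let $A$ be any finite generating set for $E$. Then $E$ has a uniform bound on depth with respect to $A$: there is an integer $K$ such that every $g\in E$ has depth at most $K$ with respect to $A$.
   Context: For an infinite group $G$ with finite generating set $A$, $d_A$ denotes the word metric, and the depth of $g\in G$ with respect to $A$ is the $d_A$-distance from $g$ to the complement in $G$ of the closed ball of radius $d_A(1,g)$ about the identity. A euclidean group is a discrete cocompact group of isometries of Euclidean space $\mathbb{R}^n$, here with $n\ge 1$; by Bieberbach's theorem such a group has a normal subgroup of finite index isomorphic to $\mathbb{Z}^n$. *)

theory Defs
  imports
    "HOL-Analysis.Analysis"
    "HOL-Algebra.Generated_Groups"
    "HOL-Algebra.Group_Action"
    "HOL-Library.Extended_Nat"
begin

section \<open>Word metric and depth\<close>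

definition group_words :: "('g, 'm) monoid_scheme \<Rightarrow> 'g set \<Rightarrow> 'g \<Rightarrow> 'g list set" where
  "group_words G A g =
     {ws. set ws \<subseteq> A \<union> m_inv G ` A \<and> foldr (mult G) ws (one G) = g}"

text \<open>\<open>LEAST\<close> is meaningful exactly when some word represents the element, which is the case
  for all of \<open>carrier G\<close> if \<open>A\<close> generates \<open>G\<close>; see \<open>group_words_nonempty\<close> below.\<close>

definition word_length :: "('g, 'm) monoid_scheme \<Rightarrow> 'g set \<Rightarrow> 'g \<Rightarrow> nat" where
  "word_length G A g = (LEAST k. \<exists>ws \<in> group_words G A g. length ws = k)"

definition word_dist :: "('g, 'm) monoid_scheme \<Rightarrow> 'g set \<Rightarrow> 'g \<Rightarrow> 'g \<Rightarrow> nat" where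
  "word_dist G A g h = word_length G A (inv\<^bsub>G\<^esub> g \<otimes>\<^bsub>G\<^esub> h)"

definition word_cball :: "('g, 'm) monoid_scheme \<Rightarrow> 'g set \<Rightarrow> nat \<Rightarrow> 'g set" where
  "word_cball G A r = {h \<in> carrier G. word_dist G A \<one>\<^bsub>G\<^esub> h \<le> r}"

text \<open>Distance to a set is an infimum of distances. It is taken in \<^typ>\<open>enat\<close> so that an empty
  complement gives \<open>\<infinity>\<close> rather than \<open>Inf {} = 0\<close>; for an infinite group with a finite
  generating set the complement is nonempty.\<close>

definition depth :: "('g, 'm) monoid_scheme \<Rightarrow> 'g set \<Rightarrow> 'g \<Rightarrow> enat" where
  "depth G A g =
     (INF h \<in> carrier G - word_cball G A (word_dist G A \<one>\<^bsub>G\<^esub> g). enat (word_dist G A g h))"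

lemma (in group) group_words_nonempty:
  assumes "A \<subseteq> carrier G" "g \<in> generate G A"
  shows "group_words G A g \<noteq> {}"
proof -
  have foldr_closed: "foldr (mult G) ws (one G) \<in> carrier G"
    if "set ws \<subseteq> A \<union> m_inv G ` A" for ws
    using that assms(1) by (induction ws) auto
  have foldr_app: "foldr (mult G) (us @ vs) (one G)
      = foldr (mult G) us (one G) \<otimes> foldr (mult G) vs (one G)"
    if "set us \<subseteq> A \<union> m_inv G ` A" "set vs \<subseteq> A \<union> m_inv G ` A" for us vs
    using that(1)
  proof (induction us)
    case Nil
    then show ?case using foldr_closed[OF that(2)] by simp
  next
    case (Cons u us)
    have "u \<in> carrier G" using Cons.prems assms(1) by auto
    then show ?case
      using Cons foldr_closed[of us] foldr_closed[OF that(2)] by (simp add: m_assoc)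
  qed
  from assms(2) show ?thesis
  proof (induction rule: generate.induct)
    case one
    have "[] \<in> group_words G A \<one>" by (simp add: group_words_def)
    then show ?case by blast
  next
    case (incl h)
    then have "[h] \<in> group_words G A h" using assms(1) by (auto simp: group_words_def)
    then show ?case by blast
  next
    case (inv h)
    then have "[inv h] \<in> group_words G A (inv h)" using assms(1) by (auto simp: group_words_def)
    then show ?case by blast
  next
    case (eng h1 h2)
    then obtain us vs where "us \<in> group_words G A h1" "vs \<in> group_words G A h2" by blast
    then have "us @ vs \<in> group_words G A (h1 \<otimes> h2)"
      using foldr_app[of us vs] by (auto simp: group_words_def)
    then show ?case by blast
  qed
qed


section \<open>Euclidean groups\<close>

definition isometry_group :: "('a::metric_space \<Rightarrow> 'a) monoid" where
  "isometry_group =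
     \<lparr>carrier = {f. bij f \<and> (\<forall>x y. dist (f x) (f y) = dist x y)}, mult = (\<circ>), one = id\<rparr>"

abbreviation isometry_subgroup :: "('a::metric_space \<Rightarrow> 'a) set \<Rightarrow> ('a \<Rightarrow> 'a) monoid" where
  "isometry_subgroup E \<equiv> isometry_group\<lparr>carrier := E\<rparr>"

lemma group_isometry_group: "group isometry_group"
proof (rule groupI)
  fix f :: "'a \<Rightarrow> 'a"
  assume f: "f \<in> carrier isometry_group"
  then have "bij f" and d: "\<And>x y. dist (f x) (f y) = dist x y"
    by (auto simp: isometry_group_def)
  have "dist (inv_into UNIV f x) (inv_into UNIV f y) = dist x y" for x y
    using d[of "inv_into UNIV f x" "inv_into UNIV f y"] \<open>bij f\<close>
    by (simp add: bij_is_surj surj_f_inv_f)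
  then have "inv_into UNIV f \<in> carrier isometry_group"
    using \<open>bij f\<close> by (simp add: isometry_group_def bij_imp_bij_inv)
  moreover have "inv_into UNIV f \<otimes>\<^bsub>isometry_group\<^esub> f = \<one>\<^bsub>isometry_group\<^esub>"
    using \<open>bij f\<close> by (simp add: isometry_group_def bij_is_inj)
  ultimately show "\<exists>g \<in> carrier isometry_group. g \<otimes>\<^bsub>isometry_group\<^esub> f = \<one>\<^bsub>isometry_group\<^esub>"
    by blast
qed (auto simp: isometry_group_def bij_comp o_assoc)

text \<open>The orbit space with the quotient topology.\<close>

definition orbit_space :: "('a::metric_space \<Rightarrow> 'a) set \<Rightarrow> 'a set topology" where
  "orbit_space E = topology (\<lambda>U. U \<subseteq> orbits (isometry_subgroup E) UNIV id \<and>
     open {x. orbit (isometry_subgroup E) id x \<in> U})"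

lemma openin_orbit_space:
  "openin (orbit_space E) U \<longleftrightarrow> U \<subseteq> orbits (isometry_subgroup E) UNIV id \<and>
     open {x. orbit (isometry_subgroup E) id x \<in> U}"
proof -
  have "istopology (\<lambda>U. U \<subseteq> orbits (isometry_subgroup E) UNIV id \<and>
      open {x. orbit (isometry_subgroup E) id x \<in> U})"
    unfolding istopology_def
  proof (intro conjI allI impI; (elim conjE)?)
    fix S T
    assume "open {x. orbit (isometry_subgroup E) id x \<in> S}"
      "open {x. orbit (isometry_subgroup E) id x \<in> T}"
    then have "open ({x. orbit (isometry_subgroup E) id x \<in> S} \<inter>
        {x. orbit (isometry_subgroup E) id x \<in> T})"
      by (rule open_Int)
    then show "open {x. orbit (isometry_subgroup E) id x \<in> S \<inter> T}"
      by (simp add: Int_def)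
  next
    fix \<K>
    assume *: "\<forall>K\<in>\<K>. K \<subseteq> orbits (isometry_subgroup E) UNIV id \<and>
      open {x. orbit (isometry_subgroup E) id x \<in> K}"
    have "{x. orbit (isometry_subgroup E) id x \<in> \<Union> \<K>} =
        (\<Union>K\<in>\<K>. {x. orbit (isometry_subgroup E) id x \<in> K})"
      by blast
    then show "open {x. orbit (isometry_subgroup E) id x \<in> \<Union> \<K>}"
      using * by auto
  qed auto
  then show ?thesis
    unfolding orbit_space_def by simp
qed

lemma quotient_map_orbit_space:
  "quotient_map euclidean (orbit_space E) (orbit (isometry_subgroup E) id)"
proof -
  have "openin (orbit_space E) (orbits (isometry_subgroup E) UNIV id)"
  proof -
    have "{x. orbit (isometry_subgroup E) id x \<in> orbits (isometry_subgroup E) UNIV id} = UNIV"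
      by (auto simp: orbits_def)
    then show ?thesis by (simp add: openin_orbit_space)
  qed
  then have "topspace (orbit_space E) = orbits (isometry_subgroup E) UNIV id"
    by (metis openin_orbit_space openin_subset openin_topspace subset_antisym)
  then show ?thesis
    unfolding quotient_map_def by (auto simp: openin_orbit_space orbits_def)
qed

text \<open>\<^const>\<open>discrete\<close> refers to the topology of pointwise convergence on the function type.
  On isometries it agrees with the compact-open topology; \<open>discrete_isometries_iff\<close> below
  states the resulting agreement of the two notions of discreteness.\<close>

definition euclidean_group :: "((real^'n) \<Rightarrow> (real^'n)) set \<Rightarrow> bool" where
  "euclidean_group E \<longleftrightarrow>
     subgroup E isometry_group \<and> discrete E \<and> compact_space (orbit_space E)"

lemma discrete_isometries_iff:
  fixes E :: "('a::metric_space \<Rightarrow> 'a) set"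
  assumes E: "E \<subseteq> carrier isometry_group"
  shows "discrete E \<longleftrightarrow>
    (\<forall>g\<in>E. \<exists>C e. compact C \<and> e > 0 \<and> (\<forall>h\<in>E. (\<forall>x\<in>C. dist (h x) (g x) < e) \<longrightarrow> h = g))"
    (is "_ \<longleftrightarrow> (\<forall>g\<in>E. ?P g)")
proof -
  have "g isolated_in E \<longleftrightarrow> ?P g" if g: "g \<in> E" for g
  proof
    assume "g isolated_in E"
    then obtain T where T: "open T" "T \<inter> E = {g}"
      by (auto simp: isolated_in_def)
    then have "openin (product_topology (\<lambda>_. euclidean) UNIV) T" "g \<in> T"
      by (auto simp: open_fun_def)
    then obtain X where X: "finite {i. X i \<noteq> (UNIV :: 'a set)}" "\<And>i. open (X i)"
      "g \<in> Pi\<^sub>E UNIV X" "Pi\<^sub>E UNIV X \<subseteq> T"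
      by (auto simp: openin_product_topology_alt)
    define C where "C = {i. X i \<noteq> UNIV}"
    have "\<exists>e>0. \<forall>y. dist y (g i) < e \<longrightarrow> y \<in> X i" for i
      using X(2)[of i] X(3) by (auto simp: open_dist)
    then obtain d where d: "\<And>i. d i > 0" "\<And>i y. dist y (g i) < d i \<Longrightarrow> y \<in> X i"
      by metis
    define e where "e = Min (insert 1 (d ` C))"
    have fin: "finite C" using X(1) by (simp add: C_def)
    have e: "e > 0" "\<And>i. i \<in> C \<Longrightarrow> e \<le> d i"
      using fin d(1) by (auto simp: e_def)
    have "h = g" if h: "h \<in> E" "\<forall>x\<in>C. dist (h x) (g x) < e" for h
    proof -
      have "h i \<in> X i" for i
      proof (cases "i \<in> C")
        case True
        then show ?thesis using h(2) e(2)[of i] d(2) by force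
      next
        case False
        then show ?thesis by (simp add: C_def)
      qed
      then have "h \<in> T" using X(4) by auto
      then show ?thesis using T(2) h(1) by blast
    qed
    then show "?P g"
      using fin e(1) finite_imp_compact by blast
  next
    assume "?P g"
    then obtain C e where C: "compact C" and e: "e > 0"
      and *: "\<And>h. h \<in> E \<Longrightarrow> (\<And>x. x \<in> C \<Longrightarrow> dist (h x) (g x) < e) \<Longrightarrow> h = g"
      by metis
    obtain D where D: "finite D" "C \<subseteq> (\<Union>x\<in>D. ball x (e/3))"
    proof (rule compactE_image[OF C, of C "\<lambda>x. ball x (e/3)"])
    show "C \<subseteq> (\<Union>x\<in>C. ball x (e/3))" using e by auto
  qed auto
    define T where "T = Pi\<^sub>E UNIV (\<lambda>i. if i \<in> D then ball (g i) (e/3) else UNIV)"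
    have "open T"
      unfolding T_def using D(1) by (intro open_PiE) (auto intro: finite_subset)
    moreover have "T \<inter> E = {g}"
    proof
      have "g \<in> T" using e by (auto simp: T_def)
      then show "{g} \<subseteq> T \<inter> E" using g by blast
      have "h = g" if h: "h \<in> T" "h \<in> E" for h
      proof (rule *[OF h(2)])
        fix x assume "x \<in> C"
        then obtain y where y: "y \<in> D" "dist y x < e/3" using D(2) by auto
        have "dist (h y) (h x) = dist y x" "dist (g y) (g x) = dist y x"
          using h(2) g E by (auto simp: isometry_group_def)
        moreover have "dist (g y) (h y) < e/3"
          using PiE_mem[OF h(1)[unfolded T_def], of y] y(1) by simp
        moreover have "dist (h x) (g x) \<le> dist (h y) (h x) + dist (g y) (h y) + dist (g y) (g x)"
          by (metis add.commute add.left_commute add_left_mono dist_commute dist_triangle order_trans)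
        ultimately show "dist (h x) (g x) < e" using y(2) by linarith
      qed
      then show "T \<inter> E \<subseteq> {g}" by blast
    qed
    ultimately show "g isolated_in E"
      using g by (auto simp: isolated_in_def)
  qed
  then show ?thesis by (auto simp: discrete_def)
qed

end

theory Submission
  imports Defs
begin

text \<open>
  By Bieberbach's theorem the rotation parts of the elements of \<open>E\<close> form a
  finite group (\<open>finite_point_group\<close>), so the translations in \<open>E\<close> form an additive group
  \<open>\<Lambda>\<close> of vectors which, like every orbit, comes within a bounded distance of every
  point of space (\<open>lattice_dense\<close>). On \<open>\<Lambda>\<close> the word length is homogeneous up to
  an additive constant: the length of \<open>v\<close> exceeds a \<open>k\<close>-th of the length of
  \<open>k v\<close> by at most \<open>C\<close>, where \<open>C\<close> depends on neither \<open>v\<close> nor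
  \<open>k\<close> (\<open>tlen_almost_homogeneous\<close>).

  Given \<open>g\<close>, take \<open>v \<in> \<Lambda>\<close> near \<open>g 0\<close> and a further
  \<open>w \<in> \<Lambda>\<close> near \<open>(1 + 1/p) v\<close>, where \<open>p\<close> is chosen so that
  \<open>v / p\<close> has Euclidean norm about \<open>R\<close>. Then \<open>p w\<close> and \<open>(p + 1) v\<close>
  nearly agree, and comparing their lengths shows that \<open>w\<close> is longer than \<open>v\<close> by at
  least a \<open>p\<close>-th of the length of \<open>v\<close>, up to a constant. Since word length is
  bounded below by a multiple of displacement, the gain grows linearly in \<open>R\<close>; for a suitable
  fixed \<open>R\<close> it outweighs all the errors (\<open>bounded_escape\<close>). The step from \<open>g\<close>
  to the translation by \<open>w\<close> moves the origin by a bounded amount, and only finitely many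
  elements do that, so its word length is bounded too.

  The homogeneity of the length is a statement about virtually abelian groups. A word whose rotation
  parts run through the finite point group contains a short subword that is a translation; cutting it
  out changes the end point by a rotated copy of that translation, which is one of finitely many
  vectors. Hence a shortest word for \<open>k v\<close> amounts to an integer combination of these vectors,
  with known costs. Dividing the coefficients by \<open>k\<close> and rounding down gives a cheap
  expression for \<open>v\<close>, up to a bounded error.
\<close>

section \<open>Linear parts and discreteness\<close>

text \<open>The rotation part of an isometry. With it an element of the group reads
  \<open>g x = lin g x + g 0\<close>.\<close>

definition lin :: "('a::real_vector \<Rightarrow> 'a) \<Rightarrow> 'a \<Rightarrow> 'a" where
  "lin g x = g x - g 0"

abbreviation finv :: "('a \<Rightarrow> 'a) \<Rightarrow> 'a \<Rightarrow> 'a" where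
  "finv g \<equiv> inv_into UNIV g"

text \<open>Discreteness enters as isolation of the identity for uniform convergence on a bounded set, and
  cocompactness as density of the orbit of the origin up to a bounded distance. The origin serves as
  base point throughout: \<open>g 0\<close> is the translation part of \<open>g\<close>.\<close>

locale crystallographic_group =
  fixes E :: "('a::euclidean_space \<Rightarrow> 'a) set"
  assumes id_mem: "id \<in> E"
    and comp_mem: "g \<in> E \<Longrightarrow> h \<in> E \<Longrightarrow> g \<circ> h \<in> E"
    and finv_mem: "g \<in> E \<Longrightarrow> finv g \<in> E"
    and bij_mem: "g \<in> E \<Longrightarrow> bij g"
    and dist_mem: "g \<in> E \<Longrightarrow> dist (g x) (g y) = dist x y"
    and isolated_id: "\<exists>C r. bounded C \<and> r > 0 \<and> (\<forall>h\<in>E. (\<forall>x\<in>C. dist (h x) x < r) \<longrightarrow> h = id)"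
    and orbit_dense: "\<exists>D. \<forall>x. \<exists>g\<in>E. dist (g 0) x \<le> D"
begin

lemma linear_lin: "g \<in> E \<Longrightarrow> linear (lin g)"
  by (rule isometry_linear) (auto simp: lin_def dist_norm norm_minus_commute dist_mem[unfolded dist_norm])

lemma norm_lin [simp]: "g \<in> E \<Longrightarrow> norm (lin g x) = norm x"
  using dist_mem[of g x 0] by (simp add: lin_def dist_norm)

lemma apply_eq_lin: "g x = lin g x + g 0"
  by (simp add: lin_def)

lemma lin_id [simp]: "lin id = id"
  by (auto simp: lin_def)

lemma lin_comp: "g \<in> E \<Longrightarrow> lin (g \<circ> h) = lin g \<circ> lin h"
  using linear_diff[OF linear_lin, of g] by (auto simp: lin_def fun_eq_iff)

lemma finv_apply [simp]: "g \<in> E \<Longrightarrow> finv g (g x) = x" "g \<in> E \<Longrightarrow> g (finv g x) = x"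
  using bij_mem[of g] by (auto simp: bij_is_inj bij_is_surj surj_f_inv_f)

lemma finv_comp [simp]: "g \<in> E \<Longrightarrow> finv g \<circ> g = id" "g \<in> E \<Longrightarrow> g \<circ> finv g = id"
  by (auto simp: fun_eq_iff)

lemma lin_finv [simp]:
  assumes "g \<in> E" shows "lin (finv g) (lin g x) = x" "lin g (lin (finv g) x) = x"
  using lin_comp[of "finv g" g] lin_comp[of g "finv g"] assms
  by (auto simp: finv_mem fun_eq_iff)

lemma finv_zero: "g \<in> E \<Longrightarrow> finv g 0 = - lin (finv g) (g 0)"
  by (simp add: lin_def)

lemma dist_finv_comp: "g \<in> E \<Longrightarrow> norm ((finv g \<circ> h) 0) = dist (h 0) (g 0)"
  using dist_mem[of "finv g" "h 0" "g 0"] by (simp add: finv_mem)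

lemma translation_eq: "lin g = id \<Longrightarrow> g = (+) (g 0)"
  by (metis add.commute apply_eq_lin ext id_apply)

text \<open>The rotation parts as elements of a space in which bounded sequences have convergent
  subsequences; all the pigeonhole arguments below rest on this.\<close>

definition rot :: "('a \<Rightarrow> 'a) \<Rightarrow> 'a \<Rightarrow>\<^sub>L 'a" where
  "rot g = Blinfun (lin g)"

lemma rot_apply [simp]: "g \<in> E \<Longrightarrow> blinfun_apply (rot g) = lin g"
  unfolding rot_def by (simp add: bounded_linear_Blinfun_apply linear_conv_bounded_linear[symmetric] linear_lin)

lemma norm_rot_le: "g \<in> E \<Longrightarrow> norm (rot g) \<le> 1"
  by (rule norm_blinfun_bound) auto

lemma rot_diff_le:
  assumes "g \<in> E" "h \<in> E"
  shows "norm (lin g x - lin h x) \<le> norm (rot g - rot h) * norm x"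
  using norm_blinfun[of "rot g - rot h" x] assms by (simp add: blinfun.diff_left)

text \<open>Infinitely many elements of bounded displacement would, by compactness, contain two distinct
  ones \<open>g\<close> and \<open>h\<close> that are arbitrarily close in rotation and translation part; then
  \<open>finv g \<circ> h\<close> is close to the identity on a bounded set without being equal to it.\<close>

lemma finite_orbit_ball: "finite {g \<in> E. norm (g 0) \<le> R}"
proof (rule ccontr)
  assume inf: "infinite {g \<in> E. norm (g 0) \<le> R}"
  obtain C r where C: "bounded C" "r > 0"
    "\<And>h. h \<in> E \<Longrightarrow> \<forall>x\<in>C. dist (h x) x < r \<Longrightarrow> h = id"
    using isolated_id by blast
  obtain b where b: "b > 0" "\<And>x. x \<in> C \<Longrightarrow> norm x \<le> b"
    using C(1) unfolding bounded_pos by blast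
  from infinite_countable_subset[OF inf]
  obtain f :: "nat \<Rightarrow> 'a \<Rightarrow> 'a" where f: "inj f" "range f \<subseteq> {g \<in> E. norm (g 0) \<le> R}"
    by (elim exE conjE)
  have fE: "f i \<in> E" "norm (f i 0) \<le> R" for i using f(2) by auto
  define F where "F i = (rot (f i), f i 0)" for i
  have "norm (F i) \<le> 1 + R" for i
    unfolding F_def using norm_Pair_le[of "rot (f i)" "f i 0"] norm_rot_le[OF fE(1), of i] fE(2)[of i] by linarith
  then have "bounded (range F)" by (auto simp: bounded_iff)
  then obtain l s where s: "strict_mono s" "(F \<circ> s) \<longlonglongrightarrow> l"
    using bounded_imp_convergent_subsequence by blast
  then have "Cauchy (F \<circ> s)" by (simp add: LIMSEQ_imp_Cauchy)
  moreover define e where "e = r / (2 * (b + 1))"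
  have e: "e > 0" using C(2) b(1) by (simp add: e_def)
  ultimately obtain K where "dist (F (s K)) (F (s (Suc K))) < e"
    unfolding Cauchy_def by (metis comp_apply le_refl le_Suc_eq)
  then have d: "norm (F (s (Suc K)) - F (s K)) < e" by (simp add: dist_norm norm_minus_commute)
  define g where "g = f (s K)"
  define h where "h = f (s (Suc K))"
  have gh: "g \<in> E" "h \<in> E" using fE by (auto simp: g_def h_def)
  have rd: "norm (rot h - rot g) < e" and td: "norm (h 0 - g 0) < e"
    using d norm_fst_le[of "rot h - rot g" "h 0 - g 0"] norm_snd_le[of "h 0 - g 0" "rot h - rot g"]
    unfolding F_def g_def h_def by auto
  have "finv g \<circ> h = id"
  proof (rule C(3), safe)
    show "finv g \<circ> h \<in> E" using gh by (simp add: comp_mem finv_mem)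
    fix x assume "x \<in> C"
    then have x: "norm x \<le> b" by (rule b)
    have "dist ((finv g \<circ> h) x) x = dist (h x) (g x)"
      using dist_mem[of "finv g" "h x" "g x"] gh by (simp add: finv_mem)
    also have "\<dots> = norm ((lin h x - lin g x) + (h 0 - g 0))"
      unfolding dist_norm by (simp add: lin_def)
    also have "\<dots> \<le> norm (rot h - rot g) * norm x + norm (h 0 - g 0)"
      using norm_triangle_ineq[of "lin h x - lin g x" "h 0 - g 0"] rot_diff_le[OF gh(2,1), of x] by linarith
    also have "\<dots> \<le> e * b + norm (h 0 - g 0)"
      using mult_mono[of "norm (rot h - rot g)" e "norm x" b] rd x e by auto
    also have "\<dots> < e * (b + 1)" using td by (simp add: algebra_simps)
    also have "e * (b + 1) = r / 2" using b(1) by (simp add: e_def field_simps)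
    also have "r / 2 < r" using C(2) by simp
    finally show "dist ((finv g \<circ> h) x) x < r" .
  qed
  then have "g = h" using gh by (metis comp_apply finv_apply(2) id_apply ext)
  then show False using f(1) s(1) by (simp add: g_def h_def inj_eq strict_mono_eq)
qed

text \<open>Choose \<open>f k\<close> in the group taking the origin near \<open>k u\<close>. Infinitely many of the
  rotation parts of the \<open>f k\<close> are close to that of one fixed \<open>a = f (s K)\<close>, and \<open>f k \<circ> finv a\<close> with
  large \<open>k\<close> is then nearly a translation in the direction \<open>u\<close>: the fixed displacement of \<open>a\<close> becomes
  negligible.\<close>

lemma exists_near_identity_in_direction:
  fixes u :: 'a
  assumes u: "norm u = 1" and e: "\<epsilon> > 0" and d: "\<delta> > 0"
  shows "\<exists>g\<in>E. g 0 \<noteq> 0 \<and> norm (g 0 - norm (g 0) *\<^sub>R u) \<le> \<delta> * norm (g 0) \<and>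
    (\<forall>x. norm (lin g x - x) \<le> \<epsilon> * norm x)"
proof -
  obtain D where "\<And>x. \<exists>g\<in>E. dist (g 0) x \<le> D" using orbit_dense by blast
  then have "\<forall>k::nat. \<exists>g. g \<in> E \<and> dist (g 0) (real k *\<^sub>R u) \<le> D" by blast
  from choice[OF this]
  obtain f where f: "\<And>k::nat. f k \<in> E" "\<And>k. dist (f k 0) (real k *\<^sub>R u) \<le> D"
    by blast
  have "bounded (range (\<lambda>k. rot (f k)))"
    unfolding bounded_iff using norm_rot_le[OF f(1)] by blast
  then obtain l s where s: "strict_mono s" "((\<lambda>k. rot (f k)) \<circ> s) \<longlonglongrightarrow> l"
    using bounded_imp_convergent_subsequence by blast
  then have "Cauchy ((\<lambda>k. rot (f k)) \<circ> s)" by (simp add: LIMSEQ_imp_Cauchy)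
  then obtain K where K: "\<And>j. j \<ge> K \<Longrightarrow> dist (rot (f (s j))) (rot (f (s K))) < \<epsilon>"
    using e unfolding Cauchy_def by (metis comp_apply le_refl)
  define a where "a = f (s K)"
  define M where "M = D + norm (a 0)"
  obtain n :: nat where n: "real n > M + 2 * M / \<delta>" using reals_Archimedean2 by blast
  define k where "k = s (max n K)"
  have k: "k \<ge> n" unfolding k_def using seq_suble[OF s(1), of "max n K"] by linarith
  define b where "b = f k"
  define g where "g = b \<circ> finv a"
  have E: "a \<in> E" "b \<in> E" "finv a \<in> E" "g \<in> E" using f(1) by (auto simp: a_def b_def g_def comp_mem finv_mem)
  have D0: "D \<ge> 0" using f(2)[of 0] zero_le_dist order_trans by blast
  have M0: "M \<ge> 0" using D0 by (simp add: M_def)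
  have near: "norm (g 0 - real k *\<^sub>R u) \<le> M"
  proof -
    have "g 0 = lin b (finv a 0) + b 0" by (simp add: g_def lin_def)
    moreover have "norm (lin b (finv a 0)) = norm (a 0)" using E by (simp add: finv_zero)
    moreover have "norm (b 0 - real k *\<^sub>R u) \<le> D" using f(2)[of k] by (simp add: b_def dist_norm)
    ultimately show ?thesis
      using norm_triangle_ineq[of "lin b (finv a 0)" "b 0 - real k *\<^sub>R u"]
      by (simp add: M_def algebra_simps)
  qed
  have ku: "norm (real k *\<^sub>R u) = real k" using u by simp
  have nd: "\<bar>norm (g 0) - real k\<bar> \<le> M"
    using near norm_triangle_ineq3[of "g 0" "real k *\<^sub>R u"] ku by linarith
  have big: "norm (g 0) > 2 * M / \<delta>" using nd n k by linarith
  have "norm (g 0 - norm (g 0) *\<^sub>R u) \<le> norm (g 0 - real k *\<^sub>R u) + norm ((real k - norm (g 0)) *\<^sub>R u)"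
    using norm_triangle_ineq[of "g 0 - real k *\<^sub>R u" "(real k - norm (g 0)) *\<^sub>R u"]
    by (simp add: algebra_simps)
  also have "\<dots> \<le> 2 * M" using near nd u by simp
  also have "\<dots> \<le> \<delta> * norm (g 0)" using big d by (simp add: field_simps)
  finally have dir: "norm (g 0 - norm (g 0) *\<^sub>R u) \<le> \<delta> * norm (g 0)" .
  have rot: "norm (lin g x - x) \<le> \<epsilon> * norm x" for x
  proof -
    define y where "y = lin (finv a) x"
    have y: "lin a y = x" "norm y = norm x" using E by (auto simp: y_def)
    have "lin g x = lin b y" using lin_comp[OF E(2), of "finv a"] by (simp add: g_def y_def)
    then have "norm (lin g x - x) \<le> norm (rot b - rot a) * norm x"
      using rot_diff_le[OF E(2,1), of y] y by simp
    moreover have "norm (rot b - rot a) \<le> \<epsilon>"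
      using K[of "max n K"] by (simp add: a_def b_def k_def dist_norm)
    ultimately show ?thesis by (meson mult_right_mono norm_ge_zero order_trans)
  qed
  have "2 * M / \<delta> \<ge> 0" using M0 d by simp
  then have "g 0 \<noteq> 0" using big by force
  then show ?thesis using dir rot E(4) by blast
qed

end

section \<open>Finiteness of the point group\<close>

text \<open>\<open>W\<close> is the space of vectors that \<open>N = A - id\<close> stretches by the maximal factor \<open>m\<close>, and \<open>V\<close> its
  orthogonal complement. With \<open>N'\<close> the adjoint of \<open>N\<close>, \<open>W\<close> is the eigenspace of \<open>N' N\<close> for the
  eigenvalue \<open>m\<^sup>2\<close>. It is invariant under \<open>A\<close> because \<open>N\<close> is normal, hence so is \<open>V\<close>.
  The maximal stretching factor \<open>m'\<close> on \<open>V\<close> is attained by compactness, and a vector attaining the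
  factor \<open>m\<close> would lie in \<open>W\<close>, so \<open>m' < m\<close>.\<close>

lemma orthogonal_transformation_spectral_gap:
  fixes A :: "'a::euclidean_space \<Rightarrow> 'a"
  assumes A: "orthogonal_transformation A" and ne: "A \<noteq> id"
  obtains W V m m' where
    "subspace W" "W \<noteq> {0}" "subspace V" "\<forall>x\<in>W. \<forall>y\<in>V. x \<bullet> y = 0"
    "\<forall>v. \<exists>x\<in>W. \<exists>y\<in>V. v = x + y" "0 \<le> m'" "m' < m"
    "\<forall>x. norm (A x - x) \<le> m * norm x"
    "\<forall>x\<in>W. A x - x \<in> W \<and> norm (A x - x) = m * norm x"
    "\<forall>y\<in>V. A y - y \<in> V \<and> norm (A y - y) \<le> m' * norm y"
proof -
  have lA: "linear A" and iA: "\<And>x y. A x \<bullet> A y = x \<bullet> y"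
    using A by (auto simp: orthogonal_transformation_def)
  have nA: "norm (A x) = norm x" for x using A by (simp add: orthogonal_transformation)
  have bA: "bij A" using A by (rule orthogonal_transformation_bij)
  define A' where "A' = inv_into UNIV A"
  have A'A [simp]: "A' (A x) = x" "A (A' x) = x" for x
    using bA by (auto simp: A'_def bij_is_inj bij_is_surj surj_f_inv_f)
  have lA': "linear A'"
    using A orthogonal_transformation_inv[of A] unfolding A'_def orthogonal_transformation_def by blast
  define N where "N x = A x - x" for x
  define N' where "N' x = A' x - x" for x
  have lN: "linear N" and lN': "linear N'"
    unfolding N_def N'_def using lA lA' by (auto intro: linear_compose_sub linear_ident)
  have adj: "N x \<bullet> y = x \<bullet> N' y" for x y
  proof -
    have "A x \<bullet> y = x \<bullet> A' y" using iA[of x "A' y"] by simp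
    then show ?thesis by (simp add: N_def N'_def inner_diff)
  qed
  have nN': "norm (N' y) = norm (N y)" for y
  proof -
    have "norm (N' y) = norm (A (N' y))" by (simp add: nA)
    also have "A (N' y) = - N y" by (simp add: N'_def N_def linear_diff[OF lA])
    finally show ?thesis by simp
  qed
  have N'N: "N' (N x) = 2 *\<^sub>R x - A x - A' x" for x
    by (simp add: N_def N'_def linear_diff[OF lA'] scaleR_2)
  have contN: "continuous_on S (\<lambda>x. norm (N x))" for S
    by (intro continuous_on_norm linear_continuous_on) (simp add: linear_conv_bounded_linear[symmetric] lN)
  obtain x0 where "A x0 \<noteq> x0" using ne by (metis eq_id_iff)
  then have x0: "N x0 \<noteq> 0" by (simp add: N_def)
  then have x00: "x0 \<noteq> 0" using linear_0[OF lN] by auto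
  have "sgn x0 \<in> sphere 0 1" using x00 by (simp add: norm_sgn)
  then obtain u where u: "norm u = 1" and umax: "\<And>x. norm x = 1 \<Longrightarrow> norm (N x) \<le> norm (N u)"
    using continuous_attains_sup[OF compact_sphere _ contN, of 0 1] by force
  define m where "m = norm (N u)"
  have scale: "norm (N x) \<le> k * norm x" if "norm (N (sgn x)) \<le> k" "x \<noteq> 0" for x k
  proof -
    have "N x = norm x *\<^sub>R N (sgn x)"
      using that(2) by (simp add: sgn_div_norm linear_cmul[OF lN])
    then show ?thesis using that(1) by (simp add: mult.commute[of k] mult_left_mono)
  qed
  have mbound: "norm (N x) \<le> m * norm x" for x
    using scale[of x m] umax[of "sgn x"] linear_0[OF lN] by (cases "x = 0") (auto simp: m_def norm_sgn)
  have m0: "m > 0"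
  proof (rule ccontr)
    assume "\<not> m > 0"
    then have "m = 0" by (simp add: m_def)
    then show False using mbound[of x0] x0 by simp
  qed
  define W where "W = {x. N' (N x) = m\<^sup>2 *\<^sub>R x}"
  define V where "V = {y. \<forall>x\<in>W. x \<bullet> y = 0}"
  \<comment> \<open>Maximal stretching makes an eigenvector: the square of the norm of \<open>N' (N x) - m\<^sup>2 x\<close> expands to
    something that is at most zero.\<close>
  have W_char: "x \<in> W" if "norm (N x) = m * norm x" for x
  proof -
    have "N' (N x) \<bullet> x = (norm (N x))\<^sup>2"
      using adj[of x "N x"] by (simp add: inner_commute power2_norm_eq_inner)
    moreover have "(norm (p - k *\<^sub>R x))\<^sup>2 = (norm p)\<^sup>2 - 2 * k * (p \<bullet> x) + k\<^sup>2 * (norm x)\<^sup>2" for p k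
      unfolding power2_norm_eq_inner
      by (simp add: inner_diff_left inner_diff_right inner_commute algebra_simps power2_eq_square)
    ultimately have "(norm (N' (N x) - m\<^sup>2 *\<^sub>R x))\<^sup>2
        = (norm (N' (N x)))\<^sup>2 - 2 * m\<^sup>2 * (norm (N x))\<^sup>2 + m ^ 4 * (norm x)\<^sup>2"
      by simp
    also have "\<dots> \<le> (m * norm (N x))\<^sup>2 - 2 * m\<^sup>2 * (norm (N x))\<^sup>2 + m ^ 4 * (norm x)\<^sup>2"
      using power_mono[OF mbound[of "N x"], of 2] nN'[of "N x"] by simp
    also have "\<dots> = 0" by (simp add: that power2_eq_square power4_eq_xxxx)
    finally show ?thesis by (simp add: W_def)
  qed
  have W_norm: "norm (N x) = m * norm x" if "x \<in> W" for x
  proof -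
    have "(norm (N x))\<^sup>2 = (m * norm x)\<^sup>2"
      using adj[of x "N x"] that by (simp add: W_def power2_norm_eq_inner power_mult_distrib)
    then show ?thesis using m0 by (simp add: power2_eq_iff_nonneg)
  qed
  have W_sub: "subspace W"
    unfolding subspace_def W_def
    by (auto simp: linear_0[OF lN] linear_0[OF lN'] linear_add[OF lN] linear_add[OF lN']
        linear_cmul[OF lN] linear_cmul[OF lN'] scaleR_right_distrib)
  have W_iff: "x \<in> W \<longleftrightarrow> 2 *\<^sub>R x - A x - A' x = m\<^sup>2 *\<^sub>R x" for x
    by (simp add: W_def N'N)
  have AW: "A x \<in> W" if "x \<in> W" for x
  proof -
    have "A (2 *\<^sub>R x - A x - A' x) = A (m\<^sup>2 *\<^sub>R x)" using that by (simp only: W_iff)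
    then show ?thesis unfolding W_iff by (simp add: linear_diff[OF lA] linear_cmul[OF lA])
  qed
  have A'W: "A' x \<in> W" if "x \<in> W" for x
  proof -
    have "A' (2 *\<^sub>R x - A x - A' x) = A' (m\<^sup>2 *\<^sub>R x)" using that by (simp only: W_iff)
    then show ?thesis unfolding W_iff by (simp add: linear_diff[OF lA'] linear_cmul[OF lA'])
  qed
  have NV: "N y \<in> V" if "y \<in> V" for y
    unfolding V_def
  proof safe
    fix x assume x: "x \<in> W"
    have "N' x \<in> W" unfolding N'_def using A'W[OF x] x W_sub by (simp add: subspace_diff)
    then have "N' x \<bullet> y = 0" using that by (simp add: V_def)
    then show "x \<bullet> N y = 0" using adj[of y x] by (metis inner_commute)
  qed
  have V_sub: "subspace V"
    unfolding subspace_def V_def by (auto simp: inner_add_right)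
  have uW: "u \<in> W" by (rule W_char) (simp add: m_def u)
  have decomp: "\<exists>x\<in>W. \<exists>y\<in>V. v = x + y" for v
  proof -
    obtain y z where "y \<in> span W" "\<forall>w\<in>span W. orthogonal z w" "v = y + z"
      by (rule orthogonal_subspace_decomp_exists[of W v]) blast
    moreover have "span W = W" using W_sub by (simp add: span_eq_iff)
    ultimately have "y \<in> W" "z \<in> V" "v = y + z"
      by (auto simp: V_def orthogonal_def inner_commute)
    then show ?thesis by blast
  qed
  obtain m' where m': "0 \<le> m'" "m' < m" "\<And>y. y \<in> V \<Longrightarrow> norm (N y) \<le> m' * norm y"
  proof (cases "V \<inter> sphere 0 1 = {}")
    case True
    have "y = 0" if "y \<in> V" for y
    proof (rule ccontr)
      assume "y \<noteq> 0"
      moreover have "sgn y \<in> V" using that V_sub by (simp add: sgn_div_norm subspace_scale)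
      ultimately show False using True by (auto simp: norm_sgn)
    qed
    then show ?thesis using that[of 0] m0 linear_0[OF lN] by auto
  next
    case False
    have "compact (V \<inter> sphere 0 1)" using closed_subspace[OF V_sub] by (intro closed_Int_compact) auto
    then obtain y where y: "y \<in> V" "norm y = 1"
      and ymax: "\<And>x. x \<in> V \<Longrightarrow> norm x = 1 \<Longrightarrow> norm (N x) \<le> norm (N y)"
      using continuous_attains_sup[OF _ False contN] by force
    have "norm (N y) \<noteq> m"
    proof
      assume "norm (N y) = m"
      then have "y \<in> W" using W_char y by simp
      then have "y \<bullet> y = 0" using y(1) by (simp add: V_def)
      then show False using y(2) by simp
    qed
    then have lt: "norm (N y) < m" using mbound[of y] y(2) by simp
    have "norm (N x) \<le> norm (N y) * norm x" if "x \<in> V" for x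
    proof (cases "x = 0")
      case False
      have "sgn x \<in> V" using that V_sub by (simp add: sgn_div_norm subspace_scale)
      then show ?thesis using ymax[of "sgn x"] False by (intro scale) (auto simp: norm_sgn)
    qed (simp add: linear_0[OF lN])
    then show ?thesis using that[of "norm (N y)"] lt by simp
  qed
  have "W \<noteq> {0}" using uW u by auto
  moreover have "\<forall>x\<in>W. \<forall>y\<in>V. x \<bullet> y = 0" by (simp add: V_def)
  moreover have "A x - x \<in> W \<and> norm (A x - x) = m * norm x" if "x \<in> W" for x
    using AW[OF that] that W_sub W_norm[OF that] by (simp add: subspace_diff N_def)
  moreover have "A y - y \<in> V \<and> norm (A y - y) \<le> m' * norm y" if "y \<in> V" for y
    using NV[OF that] m'(3)[OF that] by (simp add: N_def)
  ultimately show ?thesis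
    using that[of W V m' m] W_sub V_sub decomp m'(1,2) mbound by (simp add: N_def)
qed

context crystallographic_group
begin

lemma orthogonal_lin: "g \<in> E \<Longrightarrow> orthogonal_transformation (lin g)"
  by (simp add: orthogonal_transformation linear_lin)

text \<open>Finiteness of orbit balls turns displacement into a well-founded measure on any set of group
  elements.\<close>

lemma ex_least_displacement:
  assumes "S \<subseteq> E" "S \<noteq> {}"
  obtains a where "a \<in> S" "\<forall>b\<in>S. norm (a 0) \<le> norm (b 0)"
proof -
  obtain s where s: "s \<in> S" using assms(2) by blast
  define F where "F = {g \<in> S. norm (g 0) \<le> norm (s 0)}"
  have "finite F" using finite_orbit_ball[of "norm (s 0)"] assms(1)
    unfolding F_def by (elim rev_finite_subset) auto
  moreover have "F \<noteq> {}" using s by (auto simp: F_def)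
  ultimately obtain a where "a \<in> F" "\<And>b. b \<in> F \<Longrightarrow> norm (a 0) \<le> norm (b 0)"
    using arg_min_if_finite(1)[of F "\<lambda>g. norm (g 0)"] arg_min_least[of F _ "\<lambda>g. norm (g 0)"] by blast
  then show ?thesis
    using that[of a] by (force simp: F_def)
qed

text \<open>With \<open>A = lin a\<close>, \<open>A'\<close> its inverse, \<open>B = lin b\<close> and \<open>C = lin c\<close>, the commutator has translation part
  \<open>(A - id) (b 0) + (id - C) (b 0) + A (id - B) (A' (a 0))\<close>. Its rotation part differs from the
  identity by the commutator of \<open>A - id\<close> and \<open>B - id\<close>, up to a rotation, which is small of second
  order.\<close>

lemma commutator_estimates:
  assumes a: "a \<in> E" and b: "b \<in> E" and m: "m \<ge> 0"
    and na: "\<And>x. norm (lin a x - x) \<le> m * norm x"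
    and nb: "\<And>x. norm (lin b x - x) \<le> e * norm x"
  defines "c \<equiv> a \<circ> b \<circ> finv a \<circ> finv b"
  shows "norm (lin c x - x) \<le> 2 * m * e * norm x"
    and "norm (c 0 - (lin a (b 0) - b 0)) \<le> 2 * m * e * norm (b 0) + e * norm (a 0)"
proof -
  define A where "A = lin a"
  define B where "B = lin b"
  define A' where "A' = lin (finv a)"
  define B' where "B' = lin (finv b)"
  note defs = A_def B_def A'_def B'_def
  have [simp]: "A (A' x) = x" "A' (A x) = x" "B (B' x) = x" "B' (B x) = x"
    "norm (A x) = norm x" "norm (B x) = norm x" "norm (A' x) = norm x" "norm (B' x) = norm x" for x
    using a b by (auto simp: defs finv_mem)
  have lA: "linear A" "linear B" "linear A'" "linear B'"
    using a b by (auto simp: defs finv_mem linear_lin)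
  have "lin c = A \<circ> B \<circ> A' \<circ> B'"
    using a b by (simp add: c_def defs lin_comp comp_mem finv_mem)
  then have C: "lin c x = A (B (A' (B' x)))" for x by simp
  have near: "norm (lin c x - x) \<le> 2 * m * e * norm x" for x
  proof -
    define y where "y = A' (B' x)"
    have x: "x = B (A y)" "norm y = norm x" by (simp_all add: y_def)
    define z where "z = B y - y"
    have "lin c x - x = A (B y) - B (A y)" using x by (simp add: C y_def)
    also have "\<dots> = (A z - z) - (B (A y - y) - (A y - y))"
      by (simp add: z_def linear_diff[OF lA(1)] linear_diff[OF lA(2)])
    finally have "norm (lin c x - x) \<le> norm (A z - z) + norm (B (A y - y) - (A y - y))"
      by (simp add: norm_triangle_ineq4)
    also have "norm (A z - z) \<le> m * (e * norm y)"
      using na[of z] nb[of y] m by (metis A_def B_def mult_left_mono order_trans z_def)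
    also have "norm (B (A y - y) - (A y - y)) \<le> e * (m * norm y)"
    proof (cases "y = 0")
      case False
      then have "e \<ge> 0"
        using nb[of y] by (metis norm_ge_zero order_trans zero_le_mult_iff norm_le_zero_iff linorder_not_le)
      then show ?thesis
        using na[of y] nb[of "A y - y"] by (metis A_def B_def mult_left_mono order_trans)
    qed (simp add: linear_0[OF lA(1)] linear_0[OF lA(2)])
    finally show ?thesis by (simp add: x(2) mult_ac)
  qed
  then show "norm (lin c x - x) \<le> 2 * m * e * norm x" by blast
  define r where "r = A' (a 0)"
  have ap: "a x = A x + a 0" "b x = B x + b 0" for x
    unfolding defs by (rule apply_eq_lin)+
  have fa: "finv a x = A' x - A' (a 0)" for x
    using apply_eq_lin[of "finv a" x] a by (simp add: A'_def finv_zero)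
  have fb: "finv b 0 = - B' (b 0)"
    using b by (simp add: B'_def finv_zero)
  have "c 0 = a (b (A' (- B' (b 0)) - r))"
    by (simp add: c_def fa fb r_def)
  also have "\<dots> = A (b (A' (- B' (b 0)) - r)) + a 0" by (rule ap(1))
  also have "b (A' (- B' (b 0)) - r) = B (A' (- B' (b 0)) - r) + b 0" by (rule ap(2))
  also have "a 0 = A r" by (simp add: r_def)
  finally have "c 0 = A (B (A' (- B' (b 0)) - r) + b 0) + A r" .
  also have "\<dots> = - lin c (b 0) - A (B r) + A (b 0) + A r"
    unfolding C linear_add[OF lA(1)] linear_diff[OF lA(2)] linear_diff[OF lA(1)]
      linear_neg[OF lA(3)] linear_neg[OF lA(2)] linear_neg[OF lA(1)] by simp
  finally have "c 0 - (A (b 0) - b 0) = - (lin c (b 0) - b 0) - A (B r - r)"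
    by (simp add: linear_diff[OF lA(1)])
  then have "norm (c 0 - (A (b 0) - b 0)) \<le> norm (lin c (b 0) - b 0) + norm (B r - r)"
    using norm_triangle_ineq4[of "- (lin c (b 0) - b 0)" "A (B r - r)"] by (simp only: norm_minus_cancel) simp
  moreover have "norm (B r - r) \<le> e * norm (a 0)"
    using nb[of r] by (simp add: B_def r_def)
  ultimately show "norm (c 0 - (lin a (b 0) - b 0)) \<le> 2 * m * e * norm (b 0) + e * norm (a 0)"
    using near[of "b 0"] unfolding A_def by linarith
qed

text \<open>This is the heart of Bieberbach's theorem, in Buser's proof. Among the elements with non-trivial
  rotation part within \<open>1/2\<close> of the identity, let \<open>a\<close> have the least displacement. Let \<open>b\<close> be an element of least
  displacement among those that are almost translations and point mainly along the space \<open>W\<close>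
  that \<open>lin a - id\<close> stretches most. The commutator \<open>c\<close> of \<open>a\<close> and \<open>b\<close> is again almost a translation, its
  translation part is nearly \<open>lin a (b 0) - b 0\<close>, and by the spectral gap it again points mainly
  along \<open>W\<close>. But it is shorter than \<open>b 0\<close>, because \<open>lin a - id\<close> at least halves every vector.
  The choice of \<open>a\<close> serves to bound the error term involving \<open>a 0\<close>.\<close>

lemma near_identity_imp_translation:
  assumes g: "g \<in> E" and near: "\<And>x. norm (lin g x - x) \<le> 1/2 * norm x"
  shows "lin g = id"
proof (rule ccontr)
  assume ng: "lin g \<noteq> id"
  define S where "S = {a \<in> E. lin a \<noteq> id \<and> (\<forall>x. norm (lin a x - x) \<le> 1/2 * norm x)}"
  have "S \<noteq> {}" "S \<subseteq> E" using g near ng by (auto simp: S_def)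
  obtain a where a: "a \<in> S" and amin: "\<forall>b\<in>S. norm (a 0) \<le> norm (b 0)"
    by (rule ex_least_displacement[OF \<open>S \<subseteq> E\<close> \<open>S \<noteq> {}\<close>])
  have aE: "a \<in> E" and aid: "lin a \<noteq> id" using a by (auto simp: S_def)
  obtain W V m m' where sW: "subspace W" and W0: "W \<noteq> {0}" and sV: "subspace V"
    and orth': "\<forall>x\<in>W. \<forall>y\<in>V. x \<bullet> y = 0"
    and dec': "\<forall>v. \<exists>x\<in>W. \<exists>y\<in>V. v = x + y" and m'0: "0 \<le> m'" and m'm: "m' < m"
    and mb': "\<forall>x. norm (lin a x - x) \<le> m * norm x"
    and NW': "\<forall>x\<in>W. lin a x - x \<in> W \<and> norm (lin a x - x) = m * norm x"
    and NV': "\<forall>y\<in>V. lin a y - y \<in> V \<and> norm (lin a y - y) \<le> m' * norm y"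
    by (rule orthogonal_transformation_spectral_gap[OF orthogonal_lin[OF aE] aid])
  note orth = orth'[rule_format] and dec = dec'[rule_format] and mb = mb'[rule_format]
    and NW = NW'[rule_format] and NV = NV'[rule_format]
  have pyth: "norm x \<le> norm (x + y)" "norm y \<le> norm (x + y)" if "x \<in> W" "y \<in> V" for x y
  proof -
    have "(norm (x + y))\<^sup>2 = (norm x)\<^sup>2 + (norm y)\<^sup>2"
      using orth[OF that] by (intro norm_add_Pythagorean) (simp add: orthogonal_def)
    then show "norm x \<le> norm (x + y)" "norm y \<le> norm (x + y)"
      by (auto intro: power2_le_imp_le)
  qed
  obtain w where w: "w \<in> W" "w \<noteq> 0" using W0 subspace_0[OF sW] by blast
  define u where "u = sgn w"
  have u: "u \<in> W" "norm u = 1" using w sW by (auto simp: u_def sgn_div_norm subspace_scale norm_sgn)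
  have mh: "m \<le> 1/2"
  proof -
    have "m * norm u \<le> 1/2 * norm u" using NW[OF u(1)] a unfolding S_def by (metis (no_types, lifting) mem_Collect_eq)
    then show ?thesis using u(2) by simp
  qed
  \<comment> \<open>The rotation tolerance must be small against the spectral gap for the direction to persist.\<close>
  define e where "e = (m - m') / 8"
  have e0: "e > 0" "e \<le> m / 8" using m'm m'0 by (auto simp: e_def)
  have eh: "e \<le> 1/2" using e0 mh by linarith
  define Q where "Q = {b \<in> E. (\<forall>x. norm (lin b x - x) \<le> e * norm x) \<and>
      (\<exists>x\<in>W. \<exists>y\<in>V. b 0 = x + y \<and> norm y \<le> norm x \<and> x \<noteq> 0)}"
  have "Q \<noteq> {}"
  proof -
    obtain b where b: "b \<in> E" "b 0 \<noteq> 0" "norm (b 0 - norm (b 0) *\<^sub>R u) \<le> 1/2 * norm (b 0)"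
      "\<And>x. norm (lin b x - x) \<le> e * norm x"
      using exists_near_identity_in_direction[OF u(2) e0(1), of "1/2"] by auto
    obtain x y where xy: "x \<in> W" "y \<in> V" "b 0 - norm (b 0) *\<^sub>R u = x + y"
      using dec by blast
    define x' where "x' = norm (b 0) *\<^sub>R u + x"
    have x': "x' \<in> W" using xy u sW by (simp add: x'_def subspace_add subspace_scale)
    have "b 0 = x' + y" using xy(3) by (simp add: x'_def algebra_simps)
    moreover have "norm y \<le> norm (b 0) / 2" "norm x \<le> norm (b 0) / 2"
      using pyth[OF xy(1,2)] b(3) xy(3) by auto
    moreover have "norm (b 0) \<le> norm x' + norm x"
    proof -
      have "norm (norm (b 0) *\<^sub>R u) \<le> norm x' + norm x"
        unfolding x'_def by (metis add_diff_cancel_right' norm_triangle_ineq4)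
      then show ?thesis using u(2) by simp
    qed
    ultimately have "b 0 = x' + y \<and> norm y \<le> norm x' \<and> x' \<noteq> 0" using b(2)
      by (smt (verit) field_sum_of_halves norm_le_zero_iff norm_zero)
    then show ?thesis using b(1,4) x' xy(2) unfolding Q_def by blast
  qed
  moreover have "Q \<subseteq> E" by (auto simp: Q_def)
  ultimately obtain b where b: "b \<in> Q" and bmin: "\<forall>c\<in>Q. norm (b 0) \<le> norm (c 0)"
    by (elim ex_least_displacement[rotated])
  have bE: "b \<in> E" and nb: "\<And>x. norm (lin b x - x) \<le> e * norm x" using b by (auto simp: Q_def)
  obtain x y where xy: "x \<in> W" "y \<in> V" "b 0 = x + y" "norm y \<le> norm x" "x \<noteq> 0"
    using b by (auto simp: Q_def)
  define c where "c = a \<circ> b \<circ> finv a \<circ> finv b"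
  have cE: "c \<in> E" using aE bE by (simp add: c_def comp_mem finv_mem)
  have m0: "m \<ge> 0" using m'm m'0 by simp
  have nc: "norm (lin c z - z) \<le> e * norm z" for z
  proof -
    have "norm (lin c z - z) \<le> 2 * m * e * norm z"
      unfolding c_def by (rule commutator_estimates(1)[OF aE bE m0 mb nb])
    also have "\<dots> \<le> 1 * e * norm z"
      using mh e0 by (intro mult_right_mono) auto
    finally show ?thesis by simp
  qed
  \<comment> \<open>If \<open>b\<close> is not a translation, it competes with \<open>a\<close>, so that \<open>a 0\<close> is no longer than \<open>b 0\<close>.\<close>
  define r where "r = c 0 - (lin a (b 0) - b 0)"
  have rb: "norm r \<le> 2 * e * norm (b 0)"
  proof (cases "lin b = id")
    case True
    have "norm r \<le> 2 * m * 0 * norm (b 0) + 0 * norm (a 0)"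
      unfolding r_def c_def by (rule commutator_estimates(2)[OF aE bE m0 mb]) (simp add: True)
    also have "\<dots> \<le> 2 * e * norm (b 0)" using e0 by simp
    finally show ?thesis .
  next
    case False
    have "norm (lin b x - x) \<le> 1/2 * norm x" for x
      using nb[of x] eh by (meson mult_right_mono norm_ge_zero order_trans)
    then have "b \<in> S" using False bE by (simp add: S_def)
    then have ab: "norm (a 0) \<le> norm (b 0)" using amin by blast
    have "norm r \<le> 2 * m * e * norm (b 0) + e * norm (a 0)"
      unfolding r_def c_def by (rule commutator_estimates(2)[OF aE bE m0 mb nb])
    also have "\<dots> \<le> 1 * e * norm (b 0) + e * norm (b 0)"
      using mh e0 ab by (intro add_mono mult_right_mono mult_left_mono) auto
    finally show ?thesis by simp
  qed
  have bx: "norm (b 0) \<le> 2 * norm x" using xy(3,4) norm_triangle_ineq[of x y] by simp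
  have rx: "norm r \<le> (m - m') / 2 * norm x"
  proof -
    have "2 * e * norm (b 0) \<le> 2 * e * (2 * norm x)" using bx e0 by (intro mult_left_mono) auto
    also have "\<dots> = (m - m') / 2 * norm x" by (simp add: e_def)
    finally show ?thesis using rb by linarith
  qed
  obtain r1 r2 where r12: "r1 \<in> W" "r2 \<in> V" "r = r1 + r2" using dec by blast
  have r12n: "norm r1 \<le> norm r" "norm r2 \<le> norm r" using pyth[OF r12(1,2)] r12(3) by auto
  define c1 where "c1 = (lin a x - x) + r1"
  define c2 where "c2 = (lin a y - y) + r2"
  have c12: "c1 \<in> W" "c2 \<in> V"
    unfolding c1_def c2_def using NW[OF xy(1)] NV[OF xy(2)] r12 sW sV by (auto simp: subspace_add)
  have c0: "c 0 = c1 + c2"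
  proof -
    have "c 0 = (lin a (b 0) - b 0) + r" by (simp add: r_def)
    then show ?thesis by (simp add: c1_def c2_def xy(3) r12(3) linear_add[OF linear_lin[OF aE]])
  qed
  have xp: "norm x > 0" using xy(5) by simp
  have "norm c1 \<ge> m * norm x - norm r"
    using norm_triangle_ineq4[of c1 r1] NW[OF xy(1)] r12n(1) by (simp add: c1_def)
  then have l1: "norm c1 \<ge> (m + m') / 2 * norm x" using rx by (simp add: algebra_simps diff_divide_distrib add_divide_distrib)
  have "norm c2 \<le> m' * norm y + norm r"
    using norm_triangle_ineq[of "lin a y - y" r2] NV[OF xy(2)] r12n(2) by (simp add: c2_def)
  also have "\<dots> \<le> m' * norm x + (m - m') / 2 * norm x"
    using rx xy(4) m'0 by (intro add_mono mult_left_mono) auto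
  also have "\<dots> = (m + m') / 2 * norm x" by (simp add: field_simps)
  finally have l2: "norm c2 \<le> norm c1" using l1 by linarith
  have "(m + m') / 2 * norm x > 0" using m'0 m'm xp by simp
  then have "c1 \<noteq> 0" using l1 by auto
  then have "c \<in> Q" unfolding Q_def using cE nc c12 c0 l2 by blast
  then have "norm (b 0) \<le> norm (c 0)" using bmin by blast
  moreover have "norm (c 0) \<le> m * norm (b 0) + 2 * e * norm (b 0)"
    using norm_triangle_ineq[of "lin a (b 0) - b 0" r] mb[of "b 0"] rb by (simp add: r_def)
  moreover have "m * norm (b 0) + 2 * e * norm (b 0) \<le> 3/4 * norm (b 0)"
    using mh e0 mult_right_mono[of "m + 2 * e" "3/4" "norm (b 0)"] by (simp add: algebra_simps)
  moreover have "norm (b 0) > 0" using pyth(1)[OF xy(1,2)] xp unfolding xy(3) by linarith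
  ultimately show False by linarith
qed

text \<open>By compactness, infinitely many rotation parts would include two distinct ones within distance
  \<open>1/2\<close>; their quotient is then trivial by the previous lemma.\<close>

theorem finite_point_group: "finite (lin ` E)"
proof (rule ccontr)
  assume "infinite (lin ` E)"
  from infinite_countable_subset[OF this]
  obtain F :: "nat \<Rightarrow> 'a \<Rightarrow> 'a" where F: "inj F" "range F \<subseteq> lin ` E" by (elim exE conjE)
  then have "\<forall>k. \<exists>g. g \<in> E \<and> F k = lin g" by blast
  from choice[OF this] obtain f where f: "\<And>k. f k \<in> E" "\<And>k. F k = lin (f k)" by blast
  have "bounded (range (\<lambda>k. rot (f k)))"
    unfolding bounded_iff using norm_rot_le[OF f(1)] by blast
  then obtain l s where s: "strict_mono s" "((\<lambda>k. rot (f k)) \<circ> s) \<longlonglongrightarrow> l"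
    using bounded_imp_convergent_subsequence by blast
  then have "Cauchy ((\<lambda>k. rot (f k)) \<circ> s)" by (simp add: LIMSEQ_imp_Cauchy)
  then obtain K where "\<forall>i\<ge>K. \<forall>j\<ge>K. dist (rot (f (s i))) (rot (f (s j))) < 1/2"
    unfolding Cauchy_def comp_apply by (meson half_gt_zero zero_less_one)
  then have K: "norm (rot (f (s (Suc K))) - rot (f (s K))) \<le> 1/2"
    by (simp add: dist_norm less_imp_le)
  define a where "a = f (s K)"
  define b where "b = f (s (Suc K))"
  have E: "a \<in> E" "b \<in> E" "finv a \<in> E" using f(1) by (auto simp: a_def b_def finv_mem)
  have lc: "lin (finv a \<circ> b) x = lin (finv a) (lin b x)" for x using E by (simp add: lin_comp)
  have "lin (finv a \<circ> b) = id"
  proof (rule near_identity_imp_translation)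
    show "finv a \<circ> b \<in> E" using E by (simp add: comp_mem)
    fix x
    have "norm (lin (finv a \<circ> b) x - x) = norm (lin (finv a) (lin b x - lin a x))"
      using E by (simp add: lc linear_diff[OF linear_lin[OF E(3)]])
    also have "\<dots> \<le> norm (rot b - rot a) * norm x" using rot_diff_le[OF E(2,1)] E by simp
    also have "\<dots> \<le> 1/2 * norm x" using K by (intro mult_right_mono) (auto simp: a_def b_def)
    finally show "norm (lin (finv a \<circ> b) x - x) \<le> 1/2 * norm x" .
  qed
  then have "lin (finv a) (lin b x) = x" for x using lc by (metis id_apply)
  then have "lin b = lin a" using E by (metis ext lin_finv(2))
  then have "F (s (Suc K)) = F (s K)" by (simp add: f a_def b_def)
  then show False using F(1) s(1) by (simp add: inj_eq strict_mono_eq)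
qed

end

section \<open>Euclidean groups as crystallographic groups\<close>

lemma m_inv_isometry_subgroup:
  assumes E: "subgroup E isometry_group" and g: "g \<in> E"
  shows "m_inv (isometry_subgroup E) g = finv g" "finv g \<in> E"
proof -
  have gc: "g \<in> carrier isometry_group" using E g by (rule subgroup.mem_carrier)
  then have b: "bij g" and d: "\<And>x y. dist (g x) (g y) = dist x y"
    by (auto simp: isometry_group_def)
  have "dist (finv g x) (finv g y) = dist x y" for x y
    using d[of "finv g x" "finv g y"] b by (simp add: bij_is_surj surj_f_inv_f)
  then have fc: "finv g \<in> carrier isometry_group"
    using b by (simp add: isometry_group_def bij_imp_bij_inv)
  have "finv g \<otimes>\<^bsub>isometry_group\<^esub> g = \<one>\<^bsub>isometry_group\<^esub>"
    using b by (simp add: isometry_group_def bij_is_inj)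
  then have inv: "m_inv isometry_group g = finv g"
    using group.inv_equality[OF group_isometry_group _ gc fc] by blast
  then show "finv g \<in> E" using subgroup.m_inv_closed[OF E g] by simp
  show "m_inv (isometry_subgroup E) g = finv g"
    using group.m_inv_consistent[OF group_isometry_group E g] inv by simp
qed

text \<open>The images in the orbit space of the open invariant sets \<open>N k\<close> of points at distance less than
  \<open>k\<close> from the orbit of the origin form an increasing open cover; by compactness one of them is
  everything.\<close>

lemma cocompact_imp_orbit_dense:
  fixes E :: "('a::real_normed_vector \<Rightarrow> 'a) set"
  assumes E: "subgroup E isometry_group" and cpt: "compact_space (orbit_space E)"
  shows "\<exists>D. \<forall>x. \<exists>g\<in>E. dist (g 0) x \<le> D"
proof -
  let ?orb = "orbit (isometry_subgroup E) id"
  have top: "topspace (orbit_space E) = ?orb ` UNIV"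
    using quotient_map_orbit_space[of E] by (auto simp: quotient_map_def)
  have orb: "?orb x = {g x | g. g \<in> E}" for x
    by (simp add: orbit_def)
  have iso: "dist (g x) (g y) = dist x y" if "g \<in> E" for g x y
    using subgroup.mem_carrier[OF E that] by (auto simp: isometry_group_def)
  have comp: "g \<circ> h \<in> E" if "g \<in> E" "h \<in> E" for g h
    using subgroup.m_closed[OF E that] by (simp add: isometry_group_def)
  have idE: "id \<in> E" using subgroup.one_closed[OF E] by (simp add: isometry_group_def)
  define N where "N k = {x. \<exists>g\<in>E. dist (g 0) x < real k}" for k :: nat
  have openN: "open (N k)" for k
  proof -
    have "N k = (\<Union>g\<in>E. ball (g 0) (real k))" by (auto simp: N_def)
    then show ?thesis by auto
  qed
  have inv: "x \<in> N k" if eq: "?orb x = ?orb y" and yN: "y \<in> N k" for x y k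
  proof -
    have "y \<in> ?orb y" using idE by (auto simp: orb intro: exI[of _ id])
    then have "y \<in> ?orb x" unfolding eq .
    then obtain h where h: "h \<in> E" "y = h x" by (auto simp: orb)
    have f: "finv h \<in> E" "finv h y = x"
      using m_inv_isometry_subgroup(2)[OF E h(1)] h(2) subgroup.mem_carrier[OF E h(1)]
      by (auto simp: isometry_group_def bij_is_inj)
    obtain g where g: "g \<in> E" "dist (g 0) y < real k" using yN by (auto simp: N_def)
    have "dist ((finv h \<circ> g) 0) x < real k"
      using iso[OF f(1), of "g 0" y] f(2) g(2) by simp
    then show ?thesis using comp[OF f(1) g(1)] unfolding N_def by blast
  qed
  have op: "openin (orbit_space E) (?orb ` N k)" for k
  proof -
    have "{x. ?orb x \<in> ?orb ` N k} = N k" using inv by blast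
    then show ?thesis using openN[of k] by (auto simp: openin_orbit_space orbits_def)
  qed
  have cover: "topspace (orbit_space E) \<subseteq> \<Union> ((\<lambda>k. ?orb ` N k) ` UNIV)"
  proof
    fix X assume "X \<in> topspace (orbit_space E)"
    then obtain x where x: "X = ?orb x" by (auto simp: top)
    obtain k :: nat where "dist (id 0) x < real k" using reals_Archimedean2 by blast
    then have "x \<in> N k" using idE unfolding N_def by blast
    then show "X \<in> \<Union> ((\<lambda>k. ?orb ` N k) ` UNIV)" using x by blast
  qed
  obtain \<F> where F: "finite \<F>" "\<F> \<subseteq> (\<lambda>k. ?orb ` N k) ` UNIV" "topspace (orbit_space E) \<subseteq> \<Union> \<F>"
    using cpt op cover unfolding compact_space_alt
    by (metis (no_types, lifting) imageE)
  then obtain I where I: "finite I" "\<F> = (\<lambda>k. ?orb ` N k) ` I"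
    using finite_subset_image[OF F(1,2)] by blast
  have "\<exists>g\<in>E. dist (g 0) x \<le> real (Max (insert 0 I))" for x
  proof -
    have "?orb x \<in> \<Union> \<F>" using F(3) by (auto simp: top)
    then obtain k where k: "k \<in> I" "?orb x \<in> ?orb ` N k" using I by auto
    then have "x \<in> N k" using inv by blast
    then obtain g where "g \<in> E" "dist (g 0) x < real k" by (auto simp: N_def)
    moreover have "k \<le> Max (insert 0 I)" using k(1) I(1) by (intro Max_ge) auto
    ultimately show ?thesis by (intro bexI[of _ g]) auto
  qed
  then show ?thesis by blast
qed

lemma euclidean_group_imp_crystallographic:
  assumes "euclidean_group E"
  shows "crystallographic_group E"
proof -
  have E: "subgroup E isometry_group" and disc: "discrete E" and cpt: "compact_space (orbit_space E)"
    using assms by (auto simp: euclidean_group_def)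
  have sub: "E \<subseteq> carrier isometry_group" using E by (rule subgroup.subset)
  show ?thesis
  proof
    show idE: "id \<in> E" using subgroup.one_closed[OF E] by (simp add: isometry_group_def)
    show "g \<circ> h \<in> E" if "g \<in> E" "h \<in> E" for g h
      using subgroup.m_closed[OF E that] by (simp add: isometry_group_def)
    show "finv g \<in> E" if "g \<in> E" for g using m_inv_isometry_subgroup(2)[OF E that] .
    show "bij g" if "g \<in> E" for g using that sub by (auto simp: isometry_group_def)
    show "dist (g x) (g y) = dist x y" if "g \<in> E" for g x y using that sub by (auto simp: isometry_group_def)
    obtain C r where "compact C" "r > 0" "\<forall>h\<in>E. (\<forall>x\<in>C. dist (h x) (id x) < r) \<longrightarrow> h = id"
      using disc idE unfolding discrete_isometries_iff[OF sub] by blast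
    then show "\<exists>C r. bounded C \<and> r > 0 \<and> (\<forall>h\<in>E. (\<forall>x\<in>C. dist (h x) x < r) \<longrightarrow> h = id)"
      by (auto intro!: exI[of _ C] exI[of _ r] compact_imp_bounded)
    show "\<exists>D. \<forall>x. \<exists>g\<in>E. dist (g 0) x \<le> D"
      by (rule cocompact_imp_orbit_dense[OF E cpt])
  qed
qed

section \<open>Word length and displacement\<close>

definition eval_word :: "('a \<Rightarrow> 'a) list \<Rightarrow> 'a \<Rightarrow> 'a" where
  "eval_word ws = foldr (\<circ>) ws id"

lemma eval_word_Nil [simp]: "eval_word [] = id"
  by (simp add: eval_word_def)

lemma eval_word_Cons [simp]: "eval_word (w # ws) = w \<circ> eval_word ws"
  by (simp add: eval_word_def)

lemma eval_word_append: "eval_word (us @ vs) = eval_word us \<circ> eval_word vs"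
  by (induction us) auto

text \<open>The set \<open>S\<close> is meant to contain the inverses of the generators: words are products of elements of
  \<open>S\<close> only.\<close>

locale generated_crystallographic_group = crystallographic_group E
  for E :: "('a::euclidean_space \<Rightarrow> 'a) set" +
  fixes S :: "('a \<Rightarrow> 'a) set"
  assumes finite_S: "finite S" and S_sub: "S \<subseteq> E"
    and generated: "g \<in> E \<Longrightarrow> \<exists>ws. set ws \<subseteq> S \<and> eval_word ws = g"
begin

definition len :: "('a \<Rightarrow> 'a) \<Rightarrow> nat" where
  "len g = (LEAST k. \<exists>ws. set ws \<subseteq> S \<and> eval_word ws = g \<and> length ws = k)"

lemma eval_word_mem: "set ws \<subseteq> S \<Longrightarrow> eval_word ws \<in> E"
  using S_sub by (induction ws) (auto simp: id_mem comp_mem)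

lemma len_le: "set ws \<subseteq> S \<Longrightarrow> len (eval_word ws) \<le> length ws"
  unfolding len_def by (rule Least_le) blast

lemma len_word:
  assumes "g \<in> E"
  obtains ws where "set ws \<subseteq> S" "eval_word ws = g" "length ws = len g"
proof -
  have "\<exists>k ws. set ws \<subseteq> S \<and> eval_word ws = g \<and> length ws = k" using generated[OF assms] by blast
  then have "\<exists>ws. set ws \<subseteq> S \<and> eval_word ws = g \<and> length ws = len g"
    unfolding len_def by (rule LeastI_ex)
  then show ?thesis using that by blast
qed

lemma len_comp:
  assumes "g \<in> E" "h \<in> E"
  shows "len (g \<circ> h) \<le> len g + len h"
proof -
  obtain us where us: "set us \<subseteq> S" "eval_word us = g" "length us = len g" by (rule len_word[OF assms(1)])
  obtain vs where vs: "set vs \<subseteq> S" "eval_word vs = h" "length vs = len h" by (rule len_word[OF assms(2)])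
  show ?thesis using len_le[of "us @ vs"] us vs by (simp add: eval_word_append)
qed

lemma len_bounded_on_ball: "\<exists>B. \<forall>g\<in>E. norm (g 0) \<le> R \<longrightarrow> len g \<le> B"
proof -
  have "finite (len ` {g \<in> E. norm (g 0) \<le> R})" using finite_orbit_ball by simp
  then obtain B where "\<forall>k\<in>len ` {g \<in> E. norm (g 0) \<le> R}. k \<le> B"
    by (auto simp: finite_nat_set_iff_bounded_le)
  then show ?thesis by blast
qed

lemma displacement_le_len:
  obtains M :: real where "M > 0" "\<forall>g\<in>E. norm (g 0) \<le> M * len g"
proof -
  have "finite ((\<lambda>s. norm (s 0)) ` S)" using finite_S by simp
  then have "bdd_above ((\<lambda>s. norm (s 0)) ` S)" by simp
  then obtain M0 where M0: "\<And>s. s \<in> S \<Longrightarrow> norm (s 0) \<le> M0" by (auto simp: bdd_above_def)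
  define M where "M = max M0 1"
  have word: "norm (eval_word ws 0) \<le> M * length ws" if "set ws \<subseteq> S" for ws
    using that
  proof (induction ws)
    case (Cons w ws)
    have w: "w \<in> S" "w \<in> E" using Cons.prems S_sub by auto
    have "norm (w (eval_word ws 0)) \<le> norm (lin w (eval_word ws 0)) + norm (w 0)"
      by (metis apply_eq_lin norm_triangle_ineq)
    then show ?case using Cons M0[OF w(1)] w(2) by (simp add: M_def algebra_simps)
  qed simp
  have "norm (g 0) \<le> M * len g" if "g \<in> E" for g
    using word by (metis len_word[OF that])
  then show ?thesis using that[of M] by (simp add: M_def)
qed

text \<open>Walk back from \<open>g 0\<close> towards the origin in steps of length \<open>D + 1\<close>, each time replacing the point
  reached by an orbit point within \<open>D\<close>: every step decreases the distance to the origin by at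
  least \<open>1\<close> and costs a bounded word length.\<close>

lemma len_le_displacement:
  obtains L :: real where "L \<ge> 0" "\<forall>g\<in>E. len g \<le> L * norm (g 0) + L"
proof -
  obtain D where D: "\<And>x. \<exists>g\<in>E. dist (g 0) x \<le> D" using orbit_dense by blast
  have D0: "D \<ge> 0" using D[of 0] zero_le_dist order_trans by blast
  obtain B where B: "\<forall>g\<in>E. norm (g 0) \<le> 2 * D + 1 \<longrightarrow> len g \<le> B" using len_bounded_on_ball by blast
  have step: "len g \<le> B * (k + 1)" if "g \<in> E" "norm (g 0) \<le> real k" for g k
    using that
  proof (induction k arbitrary: g)
    case 0
    then show ?case using B D0 by auto
  next
    case (Suc k)
    show ?case
    proof (cases "norm (g 0) \<le> 2 * D + 1")
      case True
      then show ?thesis using B Suc.prems by force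
    next
      case False
      define t where "t = 1 - (D + 1) / norm (g 0)"
      obtain h where h: "h \<in> E" "dist (h 0) (t *\<^sub>R g 0) \<le> D" using D by blast
      have pos: "norm (g 0) > D + 1" using False D0 by linarith
      have t: "t \<ge> 0" "norm (t *\<^sub>R g 0) = norm (g 0) - (D + 1)" "norm (g 0 - t *\<^sub>R g 0) = D + 1"
      proof -
        have gp: "norm (g 0) > 0" using pos D0 by linarith
        then show t0: "t \<ge> 0" using pos by (simp add: t_def)
        have "t * norm (g 0) = norm (g 0) - (D + 1)" using gp by (simp add: t_def left_diff_distrib)
        then show "norm (t *\<^sub>R g 0) = norm (g 0) - (D + 1)" using t0 by simp
        have "g 0 - t *\<^sub>R g 0 = ((D + 1) / norm (g 0)) *\<^sub>R g 0" by (simp add: t_def algebra_simps)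
        then show "norm (g 0 - t *\<^sub>R g 0) = D + 1" using gp D0 by simp
      qed
      have hk: "norm (h 0) \<le> real k"
        using norm_triangle_sub[of "h 0" "t *\<^sub>R g 0"] h(2) t(2) Suc.prems(2) by (simp add: dist_norm)
      have "norm ((finv h \<circ> g) 0) \<le> 2 * D + 1"
        using dist_finv_comp[OF h(1), of g] dist_triangle[of "g 0" "h 0" "t *\<^sub>R g 0"] h(2) t(3)
        by (simp add: dist_norm norm_minus_commute)
      then have "len (finv h \<circ> g) \<le> B" using B comp_mem finv_mem h(1) Suc.prems(1) by blast
      moreover have "g = h \<circ> (finv h \<circ> g)" using h(1) by (simp add: o_assoc[symmetric] fun_eq_iff)
      ultimately have "len g \<le> len h + B"
        using len_comp[OF h(1), of "finv h \<circ> g"] comp_mem finv_mem h(1) Suc.prems(1)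
        by (metis add_left_mono order_trans)
      then show ?thesis using Suc.IH[OF h(1) hk] by simp
    qed
  qed
  have "len g \<le> (2 * real B) * norm (g 0) + 2 * real B" if "g \<in> E" for g
  proof -
    define k where "k = nat \<lceil>norm (g 0)\<rceil>"
    have k: "norm (g 0) \<le> real k" "real k \<le> norm (g 0) + 1"
    proof -
      have "real k = of_int \<lceil>norm (g 0)\<rceil>" by (simp add: k_def)
      then show "norm (g 0) \<le> real k" "real k \<le> norm (g 0) + 1" by linarith+
    qed
    have "real (len g) \<le> real (B * (k + 1))" using step[OF that k(1)] by (simp only: of_nat_le_iff)
    also have "\<dots> \<le> real B * (2 * norm (g 0) + 2)"
    proof -
      have "real (k + 1) \<le> 2 * norm (g 0) + 2"
        using k(2) norm_ge_zero[of "g 0"] unfolding of_nat_add of_nat_1 by linarith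
      then show ?thesis unfolding of_nat_mult by (rule mult_left_mono) simp
    qed
    finally show ?thesis by (simp add: algebra_simps)
  qed
  then show ?thesis using that[of "2 * real B"] by simp
qed

section \<open>The lattice of translations\<close>

definition \<Lambda> :: "'a set" where
  "\<Lambda> = {v. (+) v \<in> E}"

text \<open>Conjugation rotates translations; \<open>\<Lambda>\<close> is therefore invariant under the point group.\<close>

lemma translation_conj:
  assumes "p \<in> E"
  shows "p \<circ> (+) v \<circ> finv p = (+) (lin p v)"
proof
  fix x
  have "p (v + finv p x) = lin p (v + finv p x) + p 0" by (rule apply_eq_lin)
  also have "\<dots> = lin p v + (lin p (finv p x) + p 0)"
    by (simp add: linear_add[OF linear_lin[OF assms]])
  also have "lin p (finv p x) + p 0 = x" using apply_eq_lin[of p "finv p x"] assms by simp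
  finally show "(p \<circ> (+) v \<circ> finv p) x = lin p v + x" by simp
qed

lemma translation_lin: "g \<in> E \<Longrightarrow> lin g = id \<Longrightarrow> g 0 \<in> \<Lambda>"
  using translation_eq[of g] by (simp add: \<Lambda>_def)

lemma \<Lambda>_zero: "0 \<in> \<Lambda>"
proof -
  have "(+) (0::'a) = id" by auto
  then show ?thesis using id_mem unfolding \<Lambda>_def by (metis mem_Collect_eq)
qed

lemma translation_add: "(+) (v + w) = (+) v \<circ> (+) (w::'a)"
  by (auto simp: fun_eq_iff)

lemma \<Lambda>_add: "v \<in> \<Lambda> \<Longrightarrow> w \<in> \<Lambda> \<Longrightarrow> v + w \<in> \<Lambda>"
  by (simp add: \<Lambda>_def translation_add comp_mem)

lemma \<Lambda>_neg: assumes "v \<in> \<Lambda>" shows "- v \<in> \<Lambda>"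
proof -
  have "finv ((+) v) \<in> E" using assms finv_mem by (simp add: \<Lambda>_def)
  moreover have "finv ((+) v) = (+) (- v)"
    by (rule inv_equality) auto
  ultimately show ?thesis by (simp add: \<Lambda>_def)
qed

lemma \<Lambda>_diff: "v \<in> \<Lambda> \<Longrightarrow> w \<in> \<Lambda> \<Longrightarrow> v - w \<in> \<Lambda>"
  using \<Lambda>_add[of v "- w"] \<Lambda>_neg by simp

lemma \<Lambda>_multiple: "v \<in> \<Lambda> \<Longrightarrow> real n *\<^sub>R v \<in> \<Lambda>"
  by (induction n) (auto simp: \<Lambda>_zero \<Lambda>_add scaleR_left_distrib)

lemma \<Lambda>_sum: "(\<And>s. s \<in> I \<Longrightarrow> f s \<in> \<Lambda>) \<Longrightarrow> sum f I \<in> \<Lambda>"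
  by (induction I rule: infinite_finite_induct) (auto simp: \<Lambda>_zero \<Lambda>_add)

lemma \<Lambda>_lin: "p \<in> E \<Longrightarrow> v \<in> \<Lambda> \<Longrightarrow> lin p v \<in> \<Lambda>"
  unfolding \<Lambda>_def using translation_conj[of p v] by (metis comp_mem finv_mem mem_Collect_eq)

abbreviation tlen :: "'a \<Rightarrow> nat" where
  "tlen v \<equiv> len ((+) v)"

lemma len_ident [simp]: "len (\<lambda>x. x) = 0"
  using len_le[of "[]"] by (simp add: id_def)

lemma tlen_add: "v \<in> \<Lambda> \<Longrightarrow> w \<in> \<Lambda> \<Longrightarrow> tlen (v + w) \<le> tlen v + tlen w"
  by (simp add: \<Lambda>_def translation_add len_comp)

lemma tlen_multiple: "v \<in> \<Lambda> \<Longrightarrow> tlen (real n *\<^sub>R v) \<le> n * tlen v"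
proof (induction n)
  case 0
  show ?case by simp
next
  case (Suc n)
  then show ?case using tlen_add[OF \<open>v \<in> \<Lambda>\<close> \<Lambda>_multiple[of v n]] by (simp add: scaleR_left_distrib)
qed

lemma tlen_sum:
  assumes "finite I" "\<And>s. s \<in> I \<Longrightarrow> f s \<in> \<Lambda>"
  shows "tlen (sum f I) \<le> (\<Sum>s\<in>I. tlen (f s))"
  using assms
proof (induction I rule: finite_induct)
  case empty
  show ?case by simp
next
  case (insert s I)
  have "tlen (f s + sum f I) \<le> tlen (f s) + tlen (sum f I)"
    using insert.prems by (intro tlen_add \<Lambda>_sum) auto
  then show ?case using insert by simp
qed

text \<open>Any orbit point \<open>g 0\<close> becomes a lattice point after composing with the inverse of one of finitely
  many representatives \<open>p\<close> of the rotation parts, which moves it by a bounded amount.\<close>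

lemma lattice_dense:
  obtains D where "D \<ge> 0" "\<forall>x. \<exists>v\<in>\<Lambda>. norm (v - x) \<le> D"
proof -
  obtain D where D: "\<And>x. \<exists>g\<in>E. dist (g 0) x \<le> D" using orbit_dense by blast
  have D0: "D \<ge> 0" using D[of 0] zero_le_dist order_trans by blast
  have "\<forall>T\<in>lin ` E. \<exists>p. p \<in> E \<and> lin p = T" by blast
  from bchoice[OF this] obtain rep where rep: "\<And>T. T \<in> lin ` E \<Longrightarrow> rep T \<in> E \<and> lin (rep T) = T"
    by blast
  have "finite ((\<lambda>T. norm (rep T 0)) ` lin ` E)" using finite_point_group by simp
  then have "bdd_above ((\<lambda>T. norm (rep T 0)) ` lin ` E)" by simp
  then obtain M where M: "\<And>T. T \<in> lin ` E \<Longrightarrow> norm (rep T 0) \<le> M"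
    unfolding bdd_above_def by blast
  have M0: "M \<ge> 0" using M[of "lin id"] id_mem by (meson image_eqI norm_ge_zero order_trans)
  have "\<exists>v\<in>\<Lambda>. norm (v - x) \<le> M + D" for x
  proof -
    obtain g where g: "g \<in> E" "dist (g 0) x \<le> D" using D by blast
    define p where "p = rep (lin g)"
    have p: "p \<in> E" "lin p = lin g" "norm (p 0) \<le> M"
      using rep[of "lin g"] M[of "lin g"] g(1) by (auto simp: p_def)
    define t where "t = g \<circ> finv p"
    have tE: "t \<in> E" using g(1) p(1) by (simp add: t_def comp_mem finv_mem)
    have "lin t = id"
      using g(1) p by (simp add: t_def lin_comp fun_eq_iff flip: p(2))
    then have "t 0 \<in> \<Lambda>" using tE translation_lin by blast
    moreover have "norm (t 0 - x) \<le> M + D"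
    proof -
      have "dist (t 0) (g 0) = norm (finv p 0)" using dist_mem[OF g(1), of "finv p 0" 0] by (simp add: t_def)
      then have "dist (t 0) (g 0) \<le> M" using p by (simp add: finv_zero finv_mem)
      then show ?thesis using g(2) dist_triangle[of "t 0" x "g 0"] by (simp add: dist_norm)
    qed
    ultimately show ?thesis by blast
  qed
  then show ?thesis using that[of "M + D"] M0 D0 by simp
qed

section \<open>Cutting words into loops\<close>

text \<open>A loop is the vector contributed by a short translational subword \<open>u\<close> occurring after a prefix
  with rotation part \<open>lin p\<close>, together with its cost. Recording the rotated vector makes the
  contributions of different positions of a word add up without further twisting. The bound on the
  length is what the pigeonhole principle on rotation parts of prefixes provides.\<close>

definition loops :: "('a \<times> nat) set" where
  "loops = {(lin p v, length u) | p u v. p \<in> E \<and> set u \<subseteq> S \<and> length u \<le> card (lin ` E) \<and> eval_word u = (+) v}"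

lemma finite_loops: "finite loops"
proof -
  let ?U = "{u. set u \<subseteq> S \<and> length u \<le> card (lin ` E)}"
  have "loops \<subseteq> (\<lambda>(T, u). (T (eval_word u 0), length u)) ` (lin ` E \<times> ?U)"
    unfolding loops_def by (force simp: image_iff)
  moreover have "finite (lin ` E \<times> ?U)"
    using finite_point_group finite_lists_length_le[OF finite_S] by simp
  ultimately show ?thesis by (meson finite_imageI finite_subset)
qed

lemma loop_lattice: "s \<in> loops \<Longrightarrow> fst s \<in> \<Lambda>"
proof -
  assume "s \<in> loops"
  then obtain p u v where s: "s = (lin p v, length u)" "p \<in> E" "set u \<subseteq> S" "eval_word u = (+) v"
    unfolding loops_def by blast
  then have "v \<in> \<Lambda>" using eval_word_mem[of u] by (simp add: \<Lambda>_def)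
  then show ?thesis using s by (simp add: \<Lambda>_lin)
qed

text \<open>A multiple of a loop is spelled by going to the place \<open>p\<close> where the loop lives, running around it
  \<open>n\<close> times and coming back: the detour is paid for only once. There are finitely many loops, so one
  constant serves them all.\<close>

lemma tlen_loop_multiple:
  obtains c where "\<forall>s\<in>loops. \<forall>n. tlen (real n *\<^sub>R fst s) \<le> n * snd s + c"
proof -
  have "\<exists>c. \<forall>n. tlen (real n *\<^sub>R fst s) \<le> n * snd s + c" if sl: "s \<in> loops" for s
  proof -
    obtain p u v where s: "s = (lin p v, length u)" and p: "p \<in> E" and u: "set u \<subseteq> S" "eval_word u = (+) v"
      using sl unfolding loops_def by blast
    have v: "v \<in> \<Lambda>" using eval_word_mem[OF u(1)] u(2) by (simp add: \<Lambda>_def)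
    have "tlen (real n *\<^sub>R fst s) \<le> n * snd s + (len p + len (finv p))" for n
    proof -
      define w where "w = real n *\<^sub>R v"
      have w: "(+) w \<in> E" using \<Lambda>_multiple[OF v] by (simp add: w_def \<Lambda>_def)
      have "(+) (real n *\<^sub>R fst s) = p \<circ> (+) w \<circ> finv p"
        using translation_conj[OF p] by (simp add: s w_def linear_cmul[OF linear_lin[OF p]])
      then have "tlen (real n *\<^sub>R fst s) \<le> len p + tlen w + len (finv p)"
        using len_comp[of "p \<circ> (+) w" "finv p"] len_comp[OF p w] p w comp_mem finv_mem by fastforce
      moreover have "tlen w \<le> n * tlen v" unfolding w_def by (rule tlen_multiple[OF v])
      moreover have "n * tlen v \<le> n * snd s" using len_le[OF u(1)] u(2) by (simp add: s)
      ultimately show ?thesis by linarith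
    qed
    then show ?thesis by blast
  qed
  then have "\<forall>s\<in>loops. \<exists>c. \<forall>n. tlen (real n *\<^sub>R fst s) \<le> n * snd s + c" by blast
  from bchoice[OF this] obtain c where c: "\<And>s n. s \<in> loops \<Longrightarrow> tlen (real n *\<^sub>R fst s) \<le> n * snd s + c s"
    by blast
  have "tlen (real n *\<^sub>R fst s) \<le> n * snd s + sum c loops" if "s \<in> loops" for s n
    using c[OF that, of n] member_le_sum[OF that, of c] finite_loops by force
  then show ?thesis using that by blast
qed

text \<open>If a word is longer than the order of the point group, two of its prefixes have the same
  rotation part, so the subword between them is a translation; remove it and recurse.\<close>

lemma word_loop_decomposition:
  assumes "set w \<subseteq> S"
  shows "\<exists>n r. set r \<subseteq> S \<and> length r \<le> card (lin ` E) \<and>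
    eval_word w 0 = (\<Sum>s\<in>loops. real (n s) *\<^sub>R fst s) + eval_word r 0 \<and>
    (\<Sum>s\<in>loops. n s * snd s) \<le> length w"
  using assms
proof (induction "length w" arbitrary: w rule: less_induct)
  case less
  define N where "N = card (lin ` E)"
  show ?case
  proof (cases "length w \<le> N")
    case True
    then show ?thesis using less.prems by (intro exI[of _ "\<lambda>_. 0"] exI[of _ w]) (simp add: N_def)
  next
    case False
    define f where "f i = lin (eval_word (take i w))" for i
    have sub: "set (take i w) \<subseteq> S" "set (drop i w) \<subseteq> S" for i
      using less.prems set_take_subset[of i w] set_drop_subset[of i w] by auto
    have "f ` {..N} \<subseteq> lin ` E" using eval_word_mem[OF sub(1)] by (auto simp: f_def)
    then have "card (f ` {..N}) \<le> N" unfolding N_def using finite_point_group by (rule card_mono[rotated])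
    then have "\<not> inj_on f {..N}" using card_image[of f "{..N}"] by auto
    then obtain i j where ij: "i < j" "j \<le> N" "f i = f j"
      unfolding inj_on_def by (metis atMost_iff linorder_neqE_nat)
    define x where "x = take i w"
    define u where "u = take (j - i) (drop i w)"
    define y where "y = drop j w"
    have xu: "take j w = x @ u" unfolding x_def u_def using ij(1) by (simp flip: take_add)
    have w: "w = x @ u @ y" using xu append_take_drop_id[of j w] by (simp add: y_def)
    have inS: "set x \<subseteq> S" "set u \<subseteq> S" "set y \<subseteq> S" using less.prems unfolding w by auto
    have lu: "length u = j - i" using False ij by (simp add: u_def)
    note E = inS[THEN eval_word_mem]
    have lx: "lin (eval_word x) (lin (eval_word u) z) = lin (eval_word x) z" for z
    proof -
      have "lin (eval_word x \<circ> eval_word u) = lin (eval_word x)"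
        using ij(3) xu by (simp add: f_def x_def eval_word_append)
      then show ?thesis using lin_comp[OF E(1)] by (metis comp_apply)
    qed
    then have "lin (eval_word u) z = z" for z using lin_finv(1)[OF E(1)] by metis
    then have lu_id: "lin (eval_word u) = id" by auto
    define v where "v = eval_word u 0"
    have uv: "eval_word u = (+) v" unfolding v_def using lu_id by (rule translation_eq)
    define s where "s = (lin (eval_word x) v, length u)"
    have sl: "s \<in> loops"
      unfolding loops_def s_def using E(1) inS(2) uv lu ij by (fastforce simp: N_def)
    have "length (x @ y) < length w" using lu ij by (simp add: w)
    moreover have "set (x @ y) \<subseteq> S" using inS by simp
    ultimately obtain n r where nr: "set r \<subseteq> S" "length r \<le> card (lin ` E)"
      "eval_word (x @ y) 0 = (\<Sum>s\<in>loops. real (n s) *\<^sub>R fst s) + eval_word r 0"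
      "(\<Sum>s\<in>loops. n s * snd s) \<le> length (x @ y)"
      using less.hyps by blast
    define n' where "n' = n(s := Suc (n s))"
    have e: "eval_word w 0 = fst s + eval_word (x @ y) 0"
    proof -
      have "eval_word w 0 = eval_word x (v + eval_word y 0)" by (simp add: w eval_word_append uv)
      also have "\<dots> = lin (eval_word x) v + eval_word x (eval_word y 0)"
        using apply_eq_lin[of "eval_word x"] linear_add[OF linear_lin[OF E(1)]] by (metis add.assoc)
      finally show ?thesis by (simp add: s_def eval_word_append)
    qed
    have rest: "n' t = n t" if "t \<in> loops - {s}" for t using that by (simp add: n'_def)
    have "(\<Sum>t\<in>loops. real (n' t) *\<^sub>R fst t) = fst s + (\<Sum>t\<in>loops. real (n t) *\<^sub>R fst t)"
      using sum.remove[OF finite_loops sl, of "\<lambda>t. real (n' t) *\<^sub>R fst t"]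
        sum.remove[OF finite_loops sl, of "\<lambda>t. real (n t) *\<^sub>R fst t"] rest
      by (simp add: n'_def scaleR_left_distrib)
    moreover have "(\<Sum>t\<in>loops. n' t * snd t) = snd s + (\<Sum>t\<in>loops. n t * snd t)"
      using sum.remove[OF finite_loops sl, of "\<lambda>t. n' t * snd t"]
        sum.remove[OF finite_loops sl, of "\<lambda>t. n t * snd t"] rest
      by (simp add: n'_def)
    moreover have "length w = snd s + length (x @ y)" by (simp add: w s_def)
    ultimately show ?thesis using nr e by (intro exI[of _ n'] exI[of _ r]) auto
  qed
qed

section \<open>Almost homogeneous length and bounded depth\<close>

text \<open>Decompose a shortest word for \<open>k v\<close> into loops with multiplicities \<open>n s\<close>. The combination \<open>z\<close> of
  the loops with the rounded multiplicities \<open>n s div k\<close> costs at most a \<open>k\<close>-th of the word, up to a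
  constant, and differs from \<open>v\<close> by a bounded lattice vector, since the discarded multiplicities
  are smaller than \<open>k\<close> and are divided by \<open>k\<close>.\<close>

lemma tlen_almost_homogeneous:
  obtains C :: real where "C \<ge> 0"
    "\<forall>v\<in>\<Lambda>. \<forall>k\<ge>1. real k * tlen v \<le> tlen (real k *\<^sub>R v) + real k * C"
proof -
  obtain L :: real where L: "L \<ge> 0" "\<forall>g\<in>E. len g \<le> L * norm (g 0) + L" by (rule len_le_displacement)
  obtain M :: real where M: "M > 0" "\<forall>g\<in>E. norm (g 0) \<le> M * len g" by (rule displacement_le_len)
  obtain c where c: "\<forall>s\<in>loops. \<forall>n. tlen (real n *\<^sub>R fst s) \<le> n * snd s + c" by (rule tlen_loop_multiple)
  define N where "N = card (lin ` E)"
  define R where "R = (\<Sum>s\<in>loops. norm (fst s)) + M * N"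
  define C where "C = card loops * real c + (L * R + L)"
  have R0: "R \<ge> 0" using M(1) by (simp add: R_def sum_nonneg)
  have C0: "C \<ge> 0" using R0 L(1) by (simp add: C_def)
  have "real k * tlen v \<le> tlen (real k *\<^sub>R v) + real k * C" if v: "v \<in> \<Lambda>" and k: "k \<ge> 1" for v k
  proof -
    define K where "K = real k"
    have K: "K \<ge> 1" using k by (simp add: K_def)
    have kv: "(+) (K *\<^sub>R v) \<in> E" using \<Lambda>_multiple[OF v, of k] by (simp add: \<Lambda>_def K_def)
    obtain w where w: "set w \<subseteq> S" "eval_word w = (+) (K *\<^sub>R v)" "length w = tlen (K *\<^sub>R v)"
      by (rule len_word[OF kv])
    obtain n r where nr: "set r \<subseteq> S" "length r \<le> N"
      "eval_word w 0 = (\<Sum>s\<in>loops. real (n s) *\<^sub>R fst s) + eval_word r 0"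
      "(\<Sum>s\<in>loops. n s * snd s) \<le> length w"
      using word_loop_decomposition[OF w(1)] unfolding N_def by blast
    define q where "q s = n s div k" for s
    define z where "z = (\<Sum>s\<in>loops. real (q s) *\<^sub>R fst s)"
    have qL: "real (q s) *\<^sub>R fst s \<in> \<Lambda>" if "s \<in> loops" for s
      using loop_lattice[OF that] by (rule \<Lambda>_multiple)
    have zL: "z \<in> \<Lambda>" unfolding z_def by (rule \<Lambda>_sum[OF qL])
    have nq: "real (n s) = K * real (q s) + real (n s mod k)" for s
      unfolding K_def q_def by (metis mult_div_mod_eq of_nat_add of_nat_mult)
    have r: "norm (eval_word r 0) \<le> M * N"
    proof -
      have "norm (eval_word r 0) \<le> M * len (eval_word r)" using M(2) eval_word_mem[OF nr(1)] by blast
      also have "\<dots> \<le> M * N" using M(1) len_le[OF nr(1)] nr(2) by (intro mult_left_mono) auto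
      finally show ?thesis .
    qed
    have "K *\<^sub>R v = (\<Sum>s\<in>loops. real (n s) *\<^sub>R fst s) + eval_word r 0" using nr(3) w(2) by simp
    also have "(\<Sum>s\<in>loops. real (n s) *\<^sub>R fst s) = K *\<^sub>R z + (\<Sum>s\<in>loops. real (n s mod k) *\<^sub>R fst s)"
      unfolding z_def by (simp add: nq scaleR_left_distrib sum.distrib scaleR_sum_right)
    finally have "K *\<^sub>R (v - z) = (\<Sum>s\<in>loops. real (n s mod k) *\<^sub>R fst s) + eval_word r 0"
      by (simp add: algebra_simps)
    then have "norm (K *\<^sub>R (v - z)) \<le> norm (\<Sum>s\<in>loops. real (n s mod k) *\<^sub>R fst s) + norm (eval_word r 0)"
      by (simp only: norm_triangle_ineq)
    also have "norm (\<Sum>s\<in>loops. real (n s mod k) *\<^sub>R fst s) \<le> (\<Sum>s\<in>loops. K * norm (fst s))"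
    proof (rule sum_norm_le)
      fix s
      have "real (n s mod k) \<le> K" using k unfolding K_def by (simp add: less_imp_le)
      then show "norm (real (n s mod k) *\<^sub>R fst s) \<le> K * norm (fst s)"
        by (simp add: mult_right_mono)
    qed
    also have "\<dots> = K * (\<Sum>s\<in>loops. norm (fst s))" by (simp add: sum_distrib_left)
    also have "norm (eval_word r 0) \<le> K * (M * N)"
    proof -
      have "1 * (M * N) \<le> K * (M * N)" using K M(1) by (intro mult_right_mono) auto
      then show ?thesis using r by linarith
    qed
    finally have "K * norm (v - z) \<le> K * R" using K by (simp add: R_def distrib_left)
    then have "norm (v - z) \<le> R" using K by simp
    moreover have vz: "v - z \<in> \<Lambda>" using v zL by (rule \<Lambda>_diff)
    ultimately have tvz: "tlen (v - z) \<le> L * R + L"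
      using L mult_left_mono[of "norm (v - z)" R L] unfolding \<Lambda>_def by fastforce
    have "tlen z \<le> (\<Sum>s\<in>loops. tlen (real (q s) *\<^sub>R fst s))"
      unfolding z_def by (rule tlen_sum[OF finite_loops qL])
    also have "\<dots> \<le> (\<Sum>s\<in>loops. q s * snd s + c)" using c by (intro sum_mono) blast
    also have "\<dots> = (\<Sum>s\<in>loops. q s * snd s) + card loops * c" by (simp add: sum.distrib)
    finally have "tlen v \<le> (\<Sum>s\<in>loops. q s * snd s) + card loops * c + tlen (v - z)"
      using tlen_add[OF zL vz] by simp
    then have "real (tlen v) \<le> real ((\<Sum>s\<in>loops. q s * snd s) + card loops * c + tlen (v - z))"
      by (simp only: of_nat_le_iff)
    then have "real (tlen v) \<le> real (\<Sum>s\<in>loops. q s * snd s) + card loops * real c + real (tlen (v - z))"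
      by (simp only: of_nat_add of_nat_mult)
    then have "real (tlen v) \<le> real (\<Sum>s\<in>loops. q s * snd s) + C" using tvz by (simp add: C_def)
    then have "K * tlen v \<le> K * (real (\<Sum>s\<in>loops. q s * snd s) + C)"
      using K by (intro mult_left_mono) auto
    then have "K * tlen v \<le> K * real (\<Sum>s\<in>loops. q s * snd s) + K * C"
      by (simp only: distrib_left)
    moreover
    have "k * (\<Sum>s\<in>loops. q s * snd s) \<le> tlen (K *\<^sub>R v)"
    proof -
      have "k * (\<Sum>s\<in>loops. q s * snd s) = (\<Sum>s\<in>loops. k * q s * snd s)"
        by (simp add: sum_distrib_left mult.assoc)
      also have "\<dots> \<le> (\<Sum>s\<in>loops. n s * snd s)"
        unfolding q_def by (intro sum_mono mult_right_mono) auto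
      also have "\<dots> \<le> tlen (K *\<^sub>R v)" using nr(4) w(3) by simp
      finally show ?thesis .
    qed
    then have "real (k * (\<Sum>s\<in>loops. q s * snd s)) \<le> real (tlen (K *\<^sub>R v))"
      by (simp only: of_nat_le_iff)
    then have "K * real (\<Sum>s\<in>loops. q s * snd s) \<le> real (tlen (K *\<^sub>R v))"
      by (simp only: K_def of_nat_mult)
    ultimately show ?thesis unfolding K_def by linarith
  qed
  then show ?thesis using that[of C] C0 by blast
qed

text \<open>The element \<open>h\<close> is the translation by a lattice vector \<open>w\<close> close to \<open>(1 + 1/p) v\<close>, where
  \<open>v\<close> is a lattice vector close to \<open>g 0\<close>. The elements of small displacement are finite in number, and
  for them any one element longer than all of them will do.\<close>

theorem bounded_escape:
  assumes inf: "infinite E"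
  shows "\<exists>K. \<forall>g\<in>E. \<exists>h\<in>E. len g < len h \<and> len (finv g \<circ> h) \<le> K"
proof -
  obtain L :: real where L: "L \<ge> 0" "\<forall>g\<in>E. len g \<le> L * norm (g 0) + L" by (rule len_le_displacement)
  obtain M :: real where M: "M > 0" "\<forall>g\<in>E. norm (g 0) \<le> M * len g" by (rule displacement_le_len)
  obtain C :: real where C: "C \<ge> 0"
    "\<forall>v\<in>\<Lambda>. \<forall>k\<ge>1. real k * tlen v \<le> tlen (real k *\<^sub>R v) + real k * C"
    by (rule tlen_almost_homogeneous)
  obtain D where D: "D \<ge> 0" "\<forall>x. \<exists>v\<in>\<Lambda>. norm (v - x) \<le> D" by (rule lattice_dense)
  \<comment> \<open>The gain in length is at least \<open>R / M\<close> minus errors; this value of \<open>R\<close> leaves \<open>L * D + L + 1\<close>, enough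
    to make up for the difference in length between \<open>g\<close> and the translation by \<open>v\<close> as well.\<close>
  define R where "R = M * (2 * L * D + 2 * L + 2 * C + 1)"
  have "2 * L * D + 2 * L + 2 * C + 1 > 0" using L(1) C(1) D(1) by (intro add_nonneg_pos add_nonneg_nonneg) auto
  then have R0: "R > 0" using M(1) by (simp add: R_def)
  obtain B where B: "\<forall>g\<in>E. norm (g 0) \<le> 2 * D + 2 * R \<longrightarrow> len g \<le> B" using len_bounded_on_ball by blast
  obtain B' where B': "\<forall>g\<in>E. norm (g 0) \<le> R + D \<longrightarrow> len g \<le> B'" using len_bounded_on_ball by blast
  \<comment> \<open>Used when \<open>g\<close> has small displacement.\<close>
  obtain f where f: "f \<in> E" "len f > B'"
  proof -
    have "E \<subseteq> {g \<in> E. norm (g 0) \<le> M * B'}" if le: "\<forall>g\<in>E. len g \<le> B'"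
    proof safe
      fix g assume g: "g \<in> E"
      have "norm (g 0) \<le> M * len g" using M(2) g by blast
      also have "\<dots> \<le> M * B'" using le g M(1) by (intro mult_left_mono) auto
      finally show "norm (g 0) \<le> M * B'" .
    qed
    then have "\<not> (\<forall>g\<in>E. len g \<le> B')" using inf finite_orbit_ball finite_subset by blast
    then show ?thesis using that by (auto simp: not_le)
  qed
  obtain B'' where B'': "\<forall>g\<in>E. norm (g 0) \<le> norm (f 0) + (R + D) \<longrightarrow> len g \<le> B''"
    using len_bounded_on_ball by blast
  have "\<exists>h\<in>E. len g < len h \<and> len (finv g \<circ> h) \<le> max B B''" if g: "g \<in> E" for g
  proof -
    obtain v where v: "v \<in> \<Lambda>" "norm (v - g 0) \<le> D" using D(2) by blast
    show ?thesis
    proof (cases "norm v < R")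
      case True
      have gn: "norm (g 0) \<le> R + D" using norm_triangle_sub[of "g 0" v] True v(2) by (simp add: norm_minus_commute)
      then have "len g \<le> B'" using B' g by blast
      moreover have "norm ((finv g \<circ> f) 0) \<le> norm (f 0) + (R + D)"
        using dist_finv_comp[OF g, of f] gn norm_triangle_ineq4[of "f 0" "g 0"] by (simp add: dist_norm)
      then have "len (finv g \<circ> f) \<le> B''" using B'' g f(1) comp_mem finv_mem by blast
      ultimately show ?thesis using f by (intro bexI[of _ f]) auto
    next
      case False
      define p where "p = nat \<lfloor>norm v / R\<rfloor>"
      have vR: "norm v / R \<ge> 1" using False R0 by simp
      then have "\<lfloor>norm v / R\<rfloor> \<ge> 1" by simp
      then have p1: "p \<ge> 1" and pi: "real p = of_int \<lfloor>norm v / R\<rfloor>" by (auto simp: p_def Suc_le_eq)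
      define P where "P = real p"
      have P1: "P \<ge> 1" using p1 by (simp add: P_def)
      have "P \<le> norm v / R" "norm v / R \<le> P + 1" unfolding P_def pi by linarith+
      then have Pv: "P * R \<le> norm v" "norm v \<le> (P + 1) * R" using R0 by (simp_all add: field_simps)
      have "1 * R \<le> P * R" using P1 R0 by (intro mult_right_mono) auto
      then have "norm v \<le> P * (2 * R)" using Pv(2) by (simp add: algebra_simps)
      then have vP: "norm v / P \<le> 2 * R" using P1 by (simp add: field_simps)
      define x where "x = v + (1 / P) *\<^sub>R v"
      obtain w where w: "w \<in> \<Lambda>" "norm (w - x) \<le> D" using D(2) by blast
      \<comment> \<open>The error made in replacing \<open>(p + 1) v\<close> by \<open>p w\<close>; it is of size \<open>p D\<close>, hence of bounded size
        per unit of \<open>p\<close>.\<close>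
      define e where "e = real (p + 1) *\<^sub>R v - real p *\<^sub>R w"
      have eL: "e \<in> \<Lambda>" unfolding e_def using v(1) w(1) by (intro \<Lambda>_diff \<Lambda>_multiple)
      have "e = P *\<^sub>R (x - w)" using P1 by (simp add: e_def x_def P_def algebra_simps)
      then have "norm e \<le> P * D" using w(2) P1 by (simp add: norm_minus_commute mult_left_mono)
      then have te: "tlen e \<le> L * (P * D) + L"
        using L eL mult_left_mono[of "norm e" "P * D" L] unfolding \<Lambda>_def by fastforce
      have hom: "(P + 1) * tlen v \<le> tlen (real (p + 1) *\<^sub>R v) + (P + 1) * C"
        using C(2)[rule_format, OF v(1), of "p + 1"] by (simp add: P_def add.commute)
      have "tlen (real p *\<^sub>R w + e) \<le> tlen (real p *\<^sub>R w) + tlen e"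
        using w(1) eL by (intro tlen_add \<Lambda>_multiple)
      moreover have "real p *\<^sub>R w + e = real (p + 1) *\<^sub>R v" by (simp add: e_def)
      moreover have "tlen (real p *\<^sub>R w) \<le> p * tlen w" by (rule tlen_multiple[OF w(1)])
      ultimately have "tlen (real (p + 1) *\<^sub>R v) \<le> p * tlen w + tlen e" by simp
      then have "real (tlen (real (p + 1) *\<^sub>R v)) \<le> real (p * tlen w + tlen e)"
        by (simp only: of_nat_le_iff)
      then have "real (tlen (real (p + 1) *\<^sub>R v)) \<le> P * tlen w + tlen e"
        by (simp only: P_def of_nat_add of_nat_mult)
      then have up: "(P + 1) * tlen v \<le> P * tlen w + (L * (P * D) + L) + (P + 1) * C"
        using hom te by linarith
      have low: "P * (2 * L * D + 2 * L + 2 * C + 1) \<le> tlen v"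
      proof -
        have "P * R \<le> M * tlen v" using Pv(1) M(2) v(1) unfolding \<Lambda>_def by fastforce
        then have "M * (P * (2 * L * D + 2 * L + 2 * C + 1)) \<le> M * tlen v"
          by (simp add: R_def mult.left_commute)
        then show ?thesis using M(1) by (simp only: mult_le_cancel_left_pos)
      qed
      have "P * tlen v + P * (2 * L * D + 2 * L + 2 * C + 1) \<le> P * tlen w + P * (L * D) + P * L + P * (2 * C)"
      proof -
        have "L \<le> P * L" "C \<le> P * C" using P1 L(1) C(1) by (auto simp: mult_le_cancel_right1)
        then show ?thesis using up low by (simp add: algebra_simps)
      qed
      then have "P * (tlen v + (L * D + L + 1)) \<le> P * tlen w" by (simp add: algebra_simps)
      then have vw: "tlen v + (L * D + L + 1) \<le> tlen w" using P1 by simp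
      have vE: "(+) v \<in> E" "(+) (- v) \<in> E" "(+) w \<in> E"
        using v(1) \<Lambda>_neg[OF v(1)] w(1) by (auto simp: \<Lambda>_def)
      define t where "t = (+) (- v) \<circ> g"
      have tE: "t \<in> E" using vE g by (simp add: t_def comp_mem)
      have "norm (t 0) \<le> D" using v(2) by (simp add: t_def norm_minus_commute)
      then have "len t \<le> L * D + L" using L tE mult_left_mono[of "norm (t 0)" D L] by fastforce
      moreover have "g = (+) v \<circ> t" by (auto simp: t_def fun_eq_iff)
      then have "len g \<le> tlen v + len t" using len_comp[OF vE(1) tE] by simp
      ultimately have "len g < tlen w" using vw by linarith
      moreover have "len (finv g \<circ> (+) w) \<le> B"
      proof -
        have "norm ((finv g \<circ> (+) w) 0) = norm (w - g 0)"
          using dist_finv_comp[OF g, of "(+) w"] by (simp add: dist_norm)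
        also have "w - g 0 = (w - x) + ((1 / P) *\<^sub>R v + (v - g 0))" by (simp add: x_def)
        also have "norm \<dots> \<le> norm (w - x) + (norm ((1 / P) *\<^sub>R v) + norm (v - g 0))"
          by (meson add_left_mono norm_triangle_ineq order_trans)
        also have "\<dots> \<le> 2 * D + 2 * R" using w(2) v(2) vP P1 by simp
        finally show ?thesis using B comp_mem finv_mem g vE(3) by blast
      qed
      ultimately show ?thesis using vE(3) by (intro bexI[of _ "(+) w"]) auto
    qed
  qed
  then show ?thesis by blast
qed

end

section \<open>Depth in euclidean groups\<close>

theorem proposition3:
  fixes E A :: "((real^'n) \<Rightarrow> (real^'n)) set"
  assumes "euclidean_group E"
    and "infinite E"
    and "finite A" and "A \<subseteq> E" and "generate (isometry_subgroup E) A = E"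
  shows "\<exists>K::nat. \<forall>g\<in>E. depth (isometry_subgroup E) A g \<le> enat K"
proof -
  define G where "G = isometry_subgroup E"
  define S where "S = A \<union> m_inv G ` A"
  have E: "subgroup E isometry_group" using assms(1) by (simp add: euclidean_group_def)
  have G: "group G" unfolding G_def using E group_isometry_group by (rule subgroup.subgroup_is_group)
  have G_simps: "carrier G = E" "mult G = (\<circ>)" "one G = id"
    by (simp_all add: G_def isometry_group_def)
  have inv: "m_inv G g = finv g" "finv g \<in> E" if "g \<in> E" for g
    using m_inv_isometry_subgroup[OF E that] by (simp_all add: G_def)
  interpret crystallographic_group E
    using assms(1) by (rule euclidean_group_imp_crystallographic)
  have words: "group_words G A g = {ws. set ws \<subseteq> S \<and> eval_word ws = g}" for g
    by (simp add: group_words_def S_def G_simps eval_word_def)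
  interpret generated_crystallographic_group E S
  proof
    show "finite S" using assms(3) by (simp add: S_def)
    show "S \<subseteq> E" using assms(4) inv by (auto simp: S_def)
    show "\<exists>ws. set ws \<subseteq> S \<and> eval_word ws = g" if "g \<in> E" for g
    proof -
      have "group_words G A g \<noteq> {}"
        using group.group_words_nonempty[OF G, of A g] assms(4,5) that by (simp add: G_simps flip: G_def)
      then show ?thesis by (auto simp: words)
    qed
  qed
  have wl: "word_length G A g = len g" for g
    by (simp add: word_length_def words len_def conj_assoc)
  have wd: "word_dist G A g h = len (finv g \<circ> h)" if "g \<in> E" for g h
    using inv[OF that] by (simp add: word_dist_def wl G_simps)
  have wd1: "word_dist G A \<one>\<^bsub>G\<^esub> h = len h" for h
    using wd[OF id_mem, of h] by (simp add: G_simps)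
  obtain K where K: "\<forall>g\<in>E. \<exists>h\<in>E. len g < len h \<and> len (finv g \<circ> h) \<le> K"
    using bounded_escape[OF assms(2)] by blast
  have "depth G A g \<le> enat K" if g: "g \<in> E" for g
  proof -
    obtain h where h: "h \<in> E" "len g < len h" "len (finv g \<circ> h) \<le> K" using K g by blast
    have "h \<in> carrier G - word_cball G A (word_dist G A \<one>\<^bsub>G\<^esub> g)"
      using h(1,2) by (simp add: word_cball_def G_simps(1) wd1)
    then have "depth G A g \<le> enat (word_dist G A g h)"
      unfolding depth_def by (rule INF_lower)
    also have "\<dots> \<le> enat K" using h(3) by (simp add: wd[OF g])
    finally show ?thesis .
  qed
  then show ?thesis unfolding G_def by blast
qed

end
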